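(* Fix $n\in\mathbb N$, $d\in\mathbb N$, $\kappa>0$ and $\alpha\in[0,1]$. Consider an arbitrary SCO problem $\mathcal P=(\Theta,\mathcal Z,f)$ with $\Theta\subset\mathbb R^d$. Let $T=\mathrm{Tr}_\kappa(\mathcal P;n,\alpha)$ be the subgaussian trace value of $\mathcal P$. Then, for some (universal) constant $c>0$, every $\alpha$-learner $\mathcal A_n$ for $\mathcal P$ is $(\xi,m)$-traceable with $$\xi=\exp(-cT^2),\qquad m=c\left[\frac{n^2T^2}{n+d}-\frac{16\kappa^2n}{\exp(n+d)}\right].$$
   Context: $\mathcal M_1(\mathcal R)$ is the set of probability measures on a measurable space $\mathcal R$. An SCO (stochastic convex optimization) problem is a triple $(\Theta,\mathcal Z,f)$ with $\mathcal Z$ a data space, $\Theta\subset\mathbb R^d$ a convex parameter space (a convex body in the definition of subgaussian tracers below), and $f:\Theta\times\mathcal Z\to\mathbb R$ a loss with $f(\cdot,z)$ convex for all $z\in\mathcal Z$. With $F_{\mathcal D}(\theta)=\mathbb E_{Z\sim\mathcal D}[f(\theta,Z)]$, a (randomized) algorithm $\mathcal A_n:\mathcal Z^n\to\mathcal M_1(\Theta)$ is an $\alpha$-learner if for every $\mathcal D\in\mathcal M_1(\mathcal Z)$, $\mathbb E_{S_n\sim\mathcal D^{\otimes n},\hat\theta\sim\mathcal A_n(S_n)}[F_{\mathcal D}(\hat\theta)]-\inf_{\theta\in\Theta}F_{\mathcal D}(\theta)\le\alpha$. Traceability: a tracer is a pair $(\phi,\mathcal D)$ with $\phi:\Theta\times\mathcal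 Z\to\mathbb R$ and $\mathcal D\in\mathcal M_1(\mathcal Z)$. $\mathcal A_n$ is $(\xi,m)$-traceable if there exist a tracer $(\phi,\mathcal D)$ and $\lambda\in\mathbb R$ such that, for $(Z_0,Z_1,\dots,Z_n)\sim\mathcal D^{\otimes(n+1)}$ and $\hat\theta\sim\mathcal A_n(Z_1,\dots,Z_n)$, (i) soundness: $\Pr(\phi(\hat\theta,Z_0)\ge\lambda)\le\xi$, and (ii) recall: $\mathbb E\big[|\{i\in[n]:\phi(\hat\theta,Z_i)\ge\lambda\}|\big]\ge m$. Subgaussian norm: $\|X\|_{\psi_2}=\inf\{t:\mathbb E\exp(X^2/t^2)\le2\}$. A collection $\{X_\theta\}_{\theta\in\Theta}$ is a $\sigma$-subgaussian process w.r.t. $(\Theta,\|\cdot\|)$ if for all $\theta,\theta'\in\Theta$: $\|X_\theta-X_{\theta'}\|_{\psi_2}\le\sigma\|\theta-\theta'\|$ and $\|X_\theta\|_{\psi_2}\le\sigma\,\mathrm{diam}_{\|\cdot\|}(\Theta)$. $\|\cdot\|_\Theta$ is the Minkowski norm of the convex hull $K$ of $\Theta\cup(-\Theta)$: $\|x\|_\Theta=\inf\{\lambda>0:x\in\lambda K\}$ (so $K=\Theta$ if $\Theta$ is an origin-symmetric convex body). Subgaussian tracers at scale $\kappa$: $(\phi,\mathcal D)\in\mathfrak T_\kappa$ iff (i) with $Z\sim\mathcal D$, $\{\phi(\theta,Z)\}_{\theta\in\Theta}$ is a $1$-subgaussian process w.r.t. $(\Theta,\|\cdot\|_\Theta)$;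 (ii) $|\phi(\theta,z)|\le\kappa$ for all $\theta\in\Theta$, $z\in\mathcal Z$. Subgaussian trace value: $\mathrm{Tr}_\kappa(\mathcal P;n,\alpha)=\inf_{\mathcal A_n}\sup_{(\phi,\mathcal D)\in\mathfrak T_\kappa}\mathbb E_{S_n=(Z_1,\dots,Z_n)\sim\mathcal D^{\otimes n},\hat\theta\sim\mathcal A_n(S_n)}\big[\frac1n\sum_{i=1}^n\phi(\hat\theta,Z_i)\big]$, the infimum over all $\alpha$-learners $\mathcal A_n$ for $\mathcal P$ with $n$ samples.
   Formalization: Subgaussian tracers are also required to be separable processes in θ, and the data space must have an event other than the empty set and the whole space (the claim fails otherwise); the constant c is stated for data spaces within one arbitrary carrier type. *)

theory Defs
  imports "HOL-Probability.Probability" "HOL-Library.Function_Algebras"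
begin

text \<open>
  The dimension \<open>d\<close> is quantified inside the theorem, below the universal constant, so it must be
  a term and not a type. \<open>R\<^sup>d\<close> is the set of sequences \<open>nat \<Rightarrow> real\<close> that vanish from index \<open>d\<close> on.
  With the pointwise vector space structure the notions \<^const>\<open>convex\<close>, \<^const>\<open>convex_on\<close> and
  \<^const>\<open>hull\<close> apply; the product topology and the Borel sets of \<open>nat \<Rightarrow> real\<close> induce the
  Euclidean ones on \<open>R\<^sup>d\<close>.
\<close>

instantiation "fun" :: (type, real_vector) real_vector
begin

definition scaleR_fun :: "real \<Rightarrow> ('a \<Rightarrow> 'b) \<Rightarrow> 'a \<Rightarrow> 'b" where
  "scaleR_fun r x = (\<lambda>i. r *\<^sub>R x i)"

instance
  by standard (simp_all add: scaleR_fun_def fun_eq_iff algebra_simps)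

end

definition Rspace :: "nat \<Rightarrow> (nat \<Rightarrow> real) set" where
  "Rspace d = {x. \<forall>i\<ge>d. x i = 0}"

definition convex_body :: "nat \<Rightarrow> (nat \<Rightarrow> real) set \<Rightarrow> bool" where
  "convex_body d \<Theta> \<longleftrightarrow> \<Theta> \<subseteq> Rspace d \<and> convex \<Theta> \<and> compact \<Theta> \<and>
     (top_of_set (Rspace d)) interior_of \<Theta> \<noteq> {}"

definition Theta_norm :: "(nat \<Rightarrow> real) set \<Rightarrow> (nat \<Rightarrow> real) \<Rightarrow> real" where
  "Theta_norm \<Theta> x = Inf {l. 0 < l \<and> x \<in> (\<lambda>y. l *\<^sub>R y) ` (convex hull (\<Theta> \<union> uminus ` \<Theta>))}"

definition diam_wrt :: "((nat \<Rightarrow> real) \<Rightarrow> real) \<Rightarrow> (nat \<Rightarrow> real) set \<Rightarrow> real" where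
  "diam_wrt N \<Theta> = (SUP (s, t)\<in>\<Theta> \<times> \<Theta>. N (s - t))"

text \<open>
  A data space is a measurable space, given by a measure \<open>Z\<close> of which only \<^term>\<open>space Z\<close> and
  \<^term>\<open>sets Z\<close> are used. The set of probability measures on \<open>Z\<close> is \<^term>\<open>space (prob_algebra Z)\<close>.
\<close>

abbreviation param_space :: "(nat \<Rightarrow> real) set \<Rightarrow> (nat \<Rightarrow> real) measure" where
  "param_space \<Theta> \<equiv> restrict_space borel \<Theta>"

text \<open>
  The integrability clause says that \<open>F\<^sub>D(\<theta>)\<close> is a well-defined real number for every \<open>D\<close>, which
  the definition of an \<open>\<alpha>\<close>-learner presupposes.
\<close>

definition sco_problem ::
  "nat \<Rightarrow> (nat \<Rightarrow> real) set \<Rightarrow> 'z measure \<Rightarrow> ((nat \<Rightarrow> real) \<Rightarrow> 'z \<Rightarrow> real) \<Rightarrow> bool" where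
  "sco_problem d \<Theta> Z f \<longleftrightarrow> convex_body d \<Theta> \<and>
     (\<lambda>(\<theta>, z). f \<theta> z) \<in> borel_measurable (param_space \<Theta> \<Otimes>\<^sub>M Z) \<and>
     (\<forall>z\<in>space Z. convex_on \<Theta> (\<lambda>\<theta>. f \<theta> z)) \<and>
     (\<forall>D\<in>space (prob_algebra Z). \<forall>\<theta>\<in>\<Theta>. integrable D (f \<theta>))"

definition pop_loss :: "((nat \<Rightarrow> real) \<Rightarrow> 'z \<Rightarrow> real) \<Rightarrow> 'z measure \<Rightarrow> (nat \<Rightarrow> real) \<Rightarrow> real" where
  "pop_loss f D \<theta> = (\<integral>z. f \<theta> z \<partial>D)"

text \<open>A randomized algorithm is a Markov kernel from samples indexed by \<open>{1..n}\<close> to \<open>\<Theta>\<close>.\<close>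

type_synonym 'z alg = "(nat \<Rightarrow> 'z) \<Rightarrow> (nat \<Rightarrow> real) measure"

definition algorithm :: "(nat \<Rightarrow> real) set \<Rightarrow> 'z measure \<Rightarrow> nat \<Rightarrow> 'z alg \<Rightarrow> bool" where
  "algorithm \<Theta> Z n A \<longleftrightarrow> A \<in> (\<Pi>\<^sub>M i\<in>{1..n}. Z) \<rightarrow>\<^sub>M prob_algebra (param_space \<Theta>)"

text \<open>
  The joint law of \<open>((Z\<^sub>i)\<^sub>i, \<theta>)\<close>, where the \<open>Z\<^sub>i\<close>, \<open>i \<in> I\<close>, are i.i.d. from \<open>D\<close> and \<open>\<theta>\<close> is drawn
  from \<open>A(Z\<^sub>1, \<dots>, Z\<^sub>n)\<close>. It is used with \<open>I = {1..n}\<close> and, for a further fresh sample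
  \<open>Z\<^sub>0\<close> that \<open>A\<close> does not see, with \<open>I = {0..n}\<close>.
\<close>

definition run_law ::
  "(nat \<Rightarrow> real) set \<Rightarrow> nat set \<Rightarrow> nat \<Rightarrow> 'z measure \<Rightarrow> 'z alg \<Rightarrow> ((nat \<Rightarrow> 'z) \<times> (nat \<Rightarrow> real)) measure"
  where
  "run_law \<Theta> I n D A =
     (\<Pi>\<^sub>M i\<in>I. D) \<bind> (\<lambda>S. A (restrict S {1..n}) \<bind>
       (\<lambda>\<theta>. return ((\<Pi>\<^sub>M i\<in>I. D) \<Otimes>\<^sub>M param_space \<Theta>) (S, \<theta>)))"

definition alpha_learner ::
  "(nat \<Rightarrow> real) set \<Rightarrow> 'z measure \<Rightarrow> ((nat \<Rightarrow> real) \<Rightarrow> 'z \<Rightarrow> real) \<Rightarrow> nat \<Rightarrow> real \<Rightarrow> 'z alg \<Rightarrow> bool" where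
  "alpha_learner \<Theta> Z f n \<alpha> A \<longleftrightarrow> algorithm \<Theta> Z n A \<and>
     (\<forall>D\<in>space (prob_algebra Z).
        integrable (run_law \<Theta> {1..n} n D A) (\<lambda>(S, \<theta>). pop_loss f D \<theta>) \<and>
        (\<integral>(S, \<theta>). pop_loss f D \<theta> \<partial>run_law \<Theta> {1..n} n D A) - (INF \<theta>\<in>\<Theta>. pop_loss f D \<theta>) \<le> \<alpha>)"

definition tracer ::
  "(nat \<Rightarrow> real) set \<Rightarrow> 'z measure \<Rightarrow> ((nat \<Rightarrow> real) \<Rightarrow> 'z \<Rightarrow> real) \<Rightarrow> 'z measure \<Rightarrow> bool" where
  "tracer \<Theta> Z \<phi> D \<longleftrightarrow>
     (\<lambda>(\<theta>, z). \<phi> \<theta> z) \<in> borel_measurable (param_space \<Theta> \<Otimes>\<^sub>M Z) \<and> D \<in> space (prob_algebra Z)"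

definition traceable ::
  "(nat \<Rightarrow> real) set \<Rightarrow> 'z measure \<Rightarrow> nat \<Rightarrow> 'z alg \<Rightarrow> real \<Rightarrow> real \<Rightarrow> bool" where
  "traceable \<Theta> Z n A \<xi> m \<longleftrightarrow> (\<exists>\<phi> D l. tracer \<Theta> Z \<phi> D \<and>
     \<P>((S, \<theta>) in run_law \<Theta> {0..n} n D A. l \<le> \<phi> \<theta> (S 0)) \<le> \<xi> \<and>
     m \<le> (\<integral>(S, \<theta>). real (card {i\<in>{1..n}. l \<le> \<phi> \<theta> (S i)}) \<partial>run_law \<Theta> {0..n} n D A))"

text \<open>
  The subgaussian norm takes values in \<^typ>\<open>ereal\<close>, so that the infimum over the empty set is
  \<open>\<infinity>\<close>; the restriction \<open>0 < t\<close> is needed because \<open>x / 0 = 0\<close>.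
\<close>

definition psi2_norm :: "'w measure \<Rightarrow> ('w \<Rightarrow> real) \<Rightarrow> ereal" where
  "psi2_norm M X = Inf (ereal ` {t. 0 < t \<and> (\<integral>\<^sup>+ w. ennreal (exp ((X w)\<^sup>2 / t\<^sup>2)) \<partial>M) \<le> 2})"

definition subgaussian_process ::
  "real \<Rightarrow> (nat \<Rightarrow> real) set \<Rightarrow> ((nat \<Rightarrow> real) \<Rightarrow> real) \<Rightarrow> 'w measure \<Rightarrow> ((nat \<Rightarrow> real) \<Rightarrow> 'w \<Rightarrow> real) \<Rightarrow> bool"
  where
  "subgaussian_process \<sigma> \<Theta> N M X \<longleftrightarrow>
     (\<forall>s\<in>\<Theta>. X s \<in> borel_measurable M) \<and>
     (\<forall>s\<in>\<Theta>. \<forall>t\<in>\<Theta>. psi2_norm M (\<lambda>w. X s w - X t w) \<le> ereal (\<sigma> * N (s - t))) \<and>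
     (\<forall>s\<in>\<Theta>. psi2_norm M (X s) \<le> ereal (\<sigma> * diam_wrt N \<Theta>))"

text \<open>
  Separability in the usual sense of empirical process theory: outside one null set, every value
  \<open>X\<^sub>\<theta>\<close> is a limit of values along a sequence from a fixed countable subset of the index set.
\<close>

definition separable_process ::
  "(nat \<Rightarrow> real) set \<Rightarrow> 'w measure \<Rightarrow> ((nat \<Rightarrow> real) \<Rightarrow> 'w \<Rightarrow> real) \<Rightarrow> bool" where
  "separable_process \<Theta> M X \<longleftrightarrow> (\<exists>\<Theta>\<^sub>0\<subseteq>\<Theta>. countable \<Theta>\<^sub>0 \<and>
     (AE w in M. \<forall>\<theta>\<in>\<Theta>. \<exists>s. (\<forall>k. s k \<in> \<Theta>\<^sub>0) \<and> s \<longlonglongrightarrow> \<theta> \<and> (\<lambda>k::nat. X (s k) w) \<longlonglongrightarrow> X \<theta> w))"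

text \<open>
  The process \<open>\<phi>(\<theta>, Z)\<close> is taken to be separable, as is standard where suprema over the index set
  are controlled by chaining. The increment condition alone only constrains pairs \<open>\<theta>, \<theta>'\<close>
  one at a time: with \<open>D\<close> uniform on a sphere it is satisfied by \<open>\<phi>(\<theta>, z) = \<kappa>\<close> if \<open>\<theta> = z\<close> and \<open>0\<close>
  otherwise, which is not controlled uniformly in \<open>\<theta>\<close>.
\<close>

definition subgaussian_tracers ::
  "real \<Rightarrow> (nat \<Rightarrow> real) set \<Rightarrow> 'z measure \<Rightarrow> (((nat \<Rightarrow> real) \<Rightarrow> 'z \<Rightarrow> real) \<times> 'z measure) set" where
  "subgaussian_tracers \<kappa> \<Theta> Z = {(\<phi>, D). tracer \<Theta> Z \<phi> D \<and>
     subgaussian_process 1 \<Theta> (Theta_norm \<Theta>) D \<phi> \<and> separable_process \<Theta> D \<phi> \<and>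
     (\<forall>\<theta>\<in>\<Theta>. \<forall>z\<in>space Z. \<bar>\<phi> \<theta> z\<bar> \<le> \<kappa>)}"

definition trace_value ::
  "real \<Rightarrow> (nat \<Rightarrow> real) set \<Rightarrow> 'z measure \<Rightarrow> ((nat \<Rightarrow> real) \<Rightarrow> 'z \<Rightarrow> real) \<Rightarrow> nat \<Rightarrow> real \<Rightarrow> real" where
  "trace_value \<kappa> \<Theta> Z f n \<alpha> =
     (INF A\<in>{A. alpha_learner \<Theta> Z f n \<alpha> A}. SUP (\<phi>, D)\<in>subgaussian_tracers \<kappa> \<Theta> Z.
        \<integral>(S, \<theta>). 1 / real n * (\<Sum>i=1..n. \<phi> \<theta> (S i)) \<partial>run_law \<Theta> {1..n} n D A)"

text \<open>
  At least one event of the data space is neither empty nor everything. Otherwise all data are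
  indistinguishable, and \<open>\<phi>(\<theta>, Z\<^sub>0)\<close> and \<open>\<phi>(\<theta>, Z\<^sub>i)\<close> are equal for every tracer.
\<close>

definition nontrivial_space :: "'z measure \<Rightarrow> bool" where
  "nontrivial_space Z \<longleftrightarrow> (\<exists>E\<in>sets Z. E \<noteq> {} \<and> E \<noteq> space Z)"

end

theory Submission
  imports Defs
begin

text \<open>
  If \<open>T\<close> is below an absolute constant, a single nontrivial event already traces every algorithm.
  If \<open>T\<close> is large, take a subgaussian tracer with payoff at least \<open>T / 2\<close> against the given learner and
  threshold it at \<open>T / 4\<close>. Soundness is the subgaussian tail of \<open>\<phi>(\<theta>, Z\<^sub>0)\<close>, the fresh point being
  independent of the output. Recall follows from AM-GM once
  \<open>E sup\<^sub>\<theta> \<Sum>\<^sub>i \<phi>(\<theta>, Z\<^sub>i)\<^sup>2 \<le> 600 (n + d)\<close>, which is a chaining bound over \<open>2\<^sup>-\<^sup>k\<close>-nets of \<open>\<Theta>\<close> of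
  cardinality \<open>2\<^bsup>O(k d)\<^esup>\<close>.
\<close>

section \<open>Packing numbers\<close>

text \<open>The output depends on the sample, so its squared scores on that sample have to be
  controlled uniformly over \<open>\<Theta>\<close>. A supremum over an uncountable set may fail to
  be measurable; chaining therefore builds one measurable function of the sample,
  \<open>sample_bound\<close>, that dominates the sum for every parameter outside a single null set.
  Squares are what recall needs: a large mean alone could come from a few samples with huge scores,
  while a second moment of order n + d forces the surplus to spread over order n^2 T^2 / (n + d)
  samples. The summand n comes from independence, as the exponential moment of a sum over n samples
  is at most 2 ^ n; the summand d comes from the logarithm of the net sizes. The shape of
  \<open>\<Theta>\<close> does not enter: the Minkowski norm puts \<open>\<Theta>\<close> into its
  own unit ball, whose packing numbers are bounded in terms of d and the radius.\<close>

lemma Rspace_closed: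
  shows "0 \<in> Rspace d" "x \<in> Rspace d \<Longrightarrow> y \<in> Rspace d \<Longrightarrow> x + y \<in> Rspace d"
    "x \<in> Rspace d \<Longrightarrow> y \<in> Rspace d \<Longrightarrow> x - y \<in> Rspace d"
    "x \<in> Rspace d \<Longrightarrow> r *\<^sub>R x \<in> Rspace d"
    "x \<in> Rspace d \<Longrightarrow> - x \<in> Rspace d"
  by (auto simp: Rspace_def scaleR_fun_def)

text \<open>Comparison with the maximum of the coordinates, in both directions, stands in for the
  equivalence of norms on \<open>Rspace d\<close>. The constants b and B may depend on the norm; the
  net sizes in \<open>finite_net\<close> do not.\<close>

locale equivalent_seminorm =
  fixes d :: nat and p :: "(nat \<Rightarrow> real) \<Rightarrow> real" and b B :: real
  assumes nonneg: "x \<in> Rspace d \<Longrightarrow> 0 \<le> p x"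
    and triangle: "x \<in> Rspace d \<Longrightarrow> y \<in> Rspace d \<Longrightarrow> p (x + y) \<le> p x + p y"
    and scale: "x \<in> Rspace d \<Longrightarrow> p (r *\<^sub>R x) = \<bar>r\<bar> * p x"
    and coord_le: "x \<in> Rspace d \<Longrightarrow> \<bar>x i\<bar> \<le> b * p x"
    and le_coord: "x \<in> Rspace d \<Longrightarrow> 0 < \<delta> \<Longrightarrow> (\<And>i. i < d \<Longrightarrow> \<bar>x i\<bar> \<le> \<delta>) \<Longrightarrow> p x \<le> B * \<delta>"
    and b_pos: "0 < b" and B_pos: "0 < B"
begin

definition separated :: "real \<Rightarrow> (nat \<Rightarrow> real) set \<Rightarrow> bool" where
  "separated e F \<longleftrightarrow> (\<forall>x\<in>F. \<forall>y\<in>F. x \<noteq> y \<longrightarrow> e \<le> p (x - y))"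

lemma minus_commute: "x \<in> Rspace d \<Longrightarrow> y \<in> Rspace d \<Longrightarrow> p (x - y) = p (y - x)"
  using scale[of "y - x" "-1"] by (simp add: Rspace_closed)

lemma triangle_diff: "x \<in> Rspace d \<Longrightarrow> y \<in> Rspace d \<Longrightarrow> p (x - y) \<le> p x + p y"
  using triangle[of x "(-1) *\<^sub>R y"] scale[of y "-1"] by (simp add: Rspace_closed)

lemma triangle_via:
  assumes "x \<in> Rspace d" "y \<in> Rspace d" "z \<in> Rspace d"
  shows "p (x - z) \<le> p (x - y) + p (y - z)"
  using triangle[of "x - y" "y - z"] assms by (simp add: Rspace_closed)

lemma zero: "p 0 = 0"
  using scale[of 0 0] by (simp add: Rspace_closed)

text \<open>
  The constant \<open>C\<close> depends on the norm; it disappears in \<open>packing_bound\<close> by taking powers of \<open>F\<close>.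
\<close>

lemma crude_packing_bound:
  assumes "0 < e"
  obtains C where "0 < C" "\<And>G R. finite G \<Longrightarrow> G \<subseteq> Rspace d \<Longrightarrow> separated e G \<Longrightarrow> 1 \<le> R \<Longrightarrow>
     (\<And>x. x \<in> G \<Longrightarrow> p x \<le> R) \<Longrightarrow> real (card G) \<le> (C * R) ^ d"
proof
  \<comment> \<open>Points in the same cell of a grid of mesh \<open>\<delta>\<close> are at
    distance at most \<open>B * \<delta>\<close>, which is e / 2, so a separated set meets each cell
    at most once. \<open>coord_le\<close> bounds the number of cells per coordinate.\<close>
  define \<delta> where "\<delta> = e / (2 * B)"
  have \<delta>: "0 < \<delta>" using assms B_pos by (simp add: \<delta>_def)
  define C where "C = 2 * b / \<delta> + 2"
  show "0 < C" using b_pos \<delta> by (simp add: C_def add_pos_pos)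
  fix G R assume G: "finite G" "G \<subseteq> Rspace d" "separated e G" "1 \<le> R" "\<And>x. x \<in> G \<Longrightarrow> p x \<le> R"
  define I where "I = {\<lfloor>- (b * R / \<delta>)\<rfloor>..\<lfloor>b * R / \<delta>\<rfloor>}"
  define h where "h = (\<lambda>x::nat \<Rightarrow> real. \<lambda>i\<in>{..<d}. \<lfloor>x i / \<delta>\<rfloor>)"
  have "inj_on h G"
  proof (rule inj_onI, rule ccontr)
    fix x y assume xy: "x \<in> G" "y \<in> G" "h x = h y" "x \<noteq> y"
    have "p (x - y) \<le> B * \<delta>"
    proof (rule le_coord)
      show "x - y \<in> Rspace d" using xy G(2) by (auto intro: Rspace_closed)
      fix i assume "i < d"
      then have "\<lfloor>x i / \<delta>\<rfloor> = \<lfloor>y i / \<delta>\<rfloor>" using fun_cong[OF xy(3), of i] by (simp add: h_def)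
      then have "\<bar>x i / \<delta> - y i / \<delta>\<bar> \<le> 1" by linarith
      then have "\<bar>(x i - y i) / \<delta>\<bar> \<le> 1" by (simp add: diff_divide_distrib)
      then show "\<bar>(x - y) i\<bar> \<le> \<delta>" using \<delta> by (simp add: abs_divide)
    qed (fact \<delta>)
    moreover have "B * \<delta> < e" using assms B_pos by (simp add: \<delta>_def)
    ultimately show False using xy G(3) by (force simp: separated_def)
  qed
  moreover have "h ` G \<subseteq> {..<d} \<rightarrow>\<^sub>E I"
  proof
    fix y assume "y \<in> h ` G"
    then obtain x where x: "x \<in> G" "y = h x" by auto
    have "\<lfloor>x i / \<delta>\<rfloor> \<in> I" for i
    proof -
      have "\<bar>x i\<bar> \<le> b * R" using coord_le[of x i] G(5)[OF x(1)] G(2) x(1) b_pos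
        by (meson mult_left_mono order_less_imp_le order_trans subsetD)
      then have "\<bar>x i / \<delta>\<bar> \<le> b * R / \<delta>" using \<delta> by (simp add: abs_divide divide_right_mono)
      then have "- (b * R / \<delta>) \<le> x i / \<delta>" "x i / \<delta> \<le> b * R / \<delta>" by linarith+
      then show ?thesis unfolding I_def by (auto intro!: floor_mono)
    qed
    then show "y \<in> {..<d} \<rightarrow>\<^sub>E I" using x by (auto simp: h_def)
  qed
  moreover have "finite ({..<d} \<rightarrow>\<^sub>E I)" by (auto intro: finite_PiE simp: I_def)
  ultimately have "card G \<le> card ({..<d} \<rightarrow>\<^sub>E I)"
    by (rule card_inj_on_le)
  then have "card G \<le> card I ^ d" by (simp add: card_PiE)
  then have "real (card G) \<le> real (card I) ^ d"
    by (metis of_nat_le_iff of_nat_power)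
  also have "real (card I) \<le> C * R"
  proof -
    have "0 \<le> b * R / \<delta>" using b_pos G \<delta> by simp
    moreover have "real (card {\<lfloor>- u\<rfloor>..\<lfloor>u\<rfloor>}) \<le> 2 * u + 2" if "0 \<le> u" for u :: real
    proof -
      have "\<lfloor>- u\<rfloor> \<le> \<lfloor>u\<rfloor>" using that by (intro floor_mono) simp
      then have "real (card {\<lfloor>- u\<rfloor>..\<lfloor>u\<rfloor>}) = real_of_int (\<lfloor>u\<rfloor> - \<lfloor>- u\<rfloor> + 1)" by simp
      then show ?thesis by linarith
    qed
    ultimately have "real (card I) \<le> 2 * (b * R / \<delta>) + 2" unfolding I_def by blast
    also have "\<dots> \<le> C * R" using G(4) unfolding C_def by (simp add: algebra_simps)
    finally show ?thesis .
  qed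
  then have "real (card I) ^ d \<le> (C * R) ^ d" by (intro power_mono) auto
  finally show "real (card G) \<le> (C * R) ^ d" .
qed

text \<open>
  The set \<open>G\<close> consists of the sums \<open>\<Sum>\<^sub>j L\<^sup>j x\<^sub>j\<close> with \<open>j < k\<close>, \<open>x\<^sub>j \<in> F\<close> and \<open>L = 1 + 4 / e\<close>: the base \<open>L\<close> is so
  large that the leading digit in which two sums differ dominates the remaining ones.
\<close>

lemma separated_power:
  assumes F: "finite F" "F \<subseteq> Rspace d" "\<And>x. x \<in> F \<Longrightarrow> p x \<le> 1" "separated e F" and e: "0 < e" "e \<le> 1"
  shows "\<exists>G. finite G \<and> G \<subseteq> Rspace d \<and> (\<forall>x\<in>G. p x \<le> (1 + 4 / e) ^ k - 1) \<and>
    separated (e / 2) G \<and> card G = card F ^ k"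
proof (induction k)
  case 0
  have "p (\<lambda>_. 0) = 0" "(\<lambda>_. 0) \<in> Rspace d" using zero Rspace_closed(1)[of d] by (simp_all add: zero_fun_def)
  then show ?case by (intro exI[of _ "{\<lambda>_. 0}"]) (simp add: separated_def)
next
  case (Suc k)
  define L where "L = 1 + 4 / e"
  \<comment> \<open>The second equation fixes the base: different leading parts contribute at least
    L * (e / 2), and the last digits, at distance at most 2, leave e / 2 of it.\<close>
  have L: "2 \<le> L" "L * (e / 2) = e / 2 + 2" using e by (auto simp: L_def field_simps)
  from Suc obtain G where G: "finite G" "G \<subseteq> Rspace d" "\<And>x. x \<in> G \<Longrightarrow> p x \<le> L ^ k - 1"
    "separated (e / 2) G" "card G = card F ^ k" by (auto simp: L_def)
  define h where "h = (\<lambda>(y, x). L *\<^sub>R y + x :: nat \<Rightarrow> real)"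
  have sep: "e / 2 \<le> p (h (y, x) - h (y', x'))"
    if "y \<in> G" "y' \<in> G" "x \<in> F" "x' \<in> F" "(y, x) \<noteq> (y', x')" for y y' x x'
  proof (cases "y = y'")
    case True
    then have "h (y, x) - h (y', x') = x - x'" by (simp add: h_def)
    then show ?thesis using that True F(4) e by (force simp: separated_def)
  next
    case False
    have R: "y \<in> Rspace d" "y' \<in> Rspace d" "x \<in> Rspace d" "x' \<in> Rspace d" using that G F by auto
    have "L * (e / 2) \<le> L * p (y - y')" using False that G(4) L by (intro mult_left_mono) (auto simp: separated_def)
    also have "\<dots> = p (L *\<^sub>R (y - y'))" using scale[of "y - y'" L] R L by (simp add: Rspace_closed)
    also have "L *\<^sub>R (y - y') = (h (y, x) - h (y', x')) - (x - x')" by (simp add: h_def algebra_simps)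
    also have "p \<dots> \<le> p (h (y, x) - h (y', x')) + p (x - x')"
      using R by (intro triangle_diff) (auto simp: h_def intro!: Rspace_closed)
    also have "p (x - x') \<le> 2" using triangle_diff[of x x'] R F(3)[of x] F(3)[of x'] that by simp
    finally show ?thesis using L by linarith
  qed
  have "inj_on h (G \<times> F)"
  proof (rule inj_onI, clarify, rule ccontr)
    fix y x y' x' assume "y \<in> G" "x \<in> F" "y' \<in> G" "x' \<in> F" "h (y, x) = h (y', x')" "\<not> (y = y' \<and> x = x')"
    then show False using sep[of y y' x x'] e zero by auto
  qed
  then have "card (h ` (G \<times> F)) = card F ^ Suc k"
    using G by (simp add: card_image card_cartesian_product)
  moreover have "h ` (G \<times> F) \<subseteq> Rspace d" using G F by (auto simp: h_def intro!: Rspace_closed)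
  moreover have "separated (e / 2) (h ` (G \<times> F))" using sep by (auto simp: separated_def)
  moreover have "p (h (y, x)) \<le> L ^ Suc k - 1" if "y \<in> G" "x \<in> F" for y x
  proof -
    have "p (h (y, x)) \<le> p (L *\<^sub>R y) + p x" using that G F by (auto simp: h_def intro!: triangle Rspace_closed)
    also have "p (L *\<^sub>R y) = L * p y" using scale[of y L] that G L by auto
    also have "\<dots> \<le> L * (L ^ k - 1)" using G(3)[OF that(1)] L by (intro mult_left_mono) auto
    also have "p x \<le> 1" using F that by auto
    finally show ?thesis using L by (simp add: algebra_simps)
  qed
  ultimately show ?case using G F by (intro exI[of _ "h ` (G \<times> F)"]) (auto simp: L_def)
qed

text \<open>
  This is the usual volumetric bound, obtained by comparing \<open>(card F)\<^sup>k\<close> with \<open>(C L\<^sup>k)\<^sup>d\<close> as \<open>k \<rightarrow> \<infinity>\<close>, so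
  that no Lebesgue measure on \<open>R\<^sup>d\<close> is needed.
\<close>

lemma packing_bound:
  assumes F: "finite F" "F \<subseteq> Rspace d" "\<And>x. x \<in> F \<Longrightarrow> p x \<le> 1" "separated e F" and e: "0 < e" "e \<le> 1"
  shows "real (card F) \<le> (1 + 4 / e) ^ d"
proof (rule ccontr)
  define L where "L = 1 + 4 / e"
  have L: "1 < L" using e by (auto simp: L_def)
  assume "\<not> ?thesis"
  moreover have "0 < L ^ d" using L by simp
  ultimately have "1 < real (card F) / L ^ d" by (simp add: L_def less_divide_eq)
  obtain C where C: "0 < C" "\<And>G R. finite G \<Longrightarrow> G \<subseteq> Rspace d \<Longrightarrow> separated (e / 2) G \<Longrightarrow> 1 \<le> R \<Longrightarrow>
     (\<And>x. x \<in> G \<Longrightarrow> p x \<le> R) \<Longrightarrow> real (card G) \<le> (C * R) ^ d"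
    using crude_packing_bound[of "e / 2"] e by auto
  obtain k where k: "C ^ d < (real (card F) / L ^ d) ^ k"
    using real_arch_pow[OF \<open>1 < real (card F) / L ^ d\<close>] by blast
  obtain G where G: "finite G" "G \<subseteq> Rspace d" "\<And>x. x \<in> G \<Longrightarrow> p x \<le> L ^ k - 1"
    "separated (e / 2) G" "card G = card F ^ k"
    using separated_power[OF F e, of k] by (auto simp: L_def)
  have "real (card G) \<le> (C * L ^ k) ^ d"
    using L by (intro C G) (auto intro: order_trans[OF G(3)])
  then have "real (card F) ^ k \<le> C ^ d * (L ^ d) ^ k"
    by (simp add: G(5) power_mult_distrib power_mult[symmetric] mult.commute)
  then show False using k L by (simp add: power_divide field_simps)
qed

text \<open>A separated subset of \<open>\<Theta>\<close> of largest cardinality is a net, since a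
  point farther than e from all of it could be added. \<open>packing_bound\<close> guarantees that a
  largest one exists.\<close>

lemma finite_net:
  assumes \<Theta>: "\<Theta> \<subseteq> Rspace d" "\<And>x. x \<in> \<Theta> \<Longrightarrow> p x \<le> 1" and e: "0 < e" "e \<le> 1"
  obtains F where "finite F" "F \<subseteq> \<Theta>" "real (card F) \<le> (1 + 4 / e) ^ d" "\<And>x. x \<in> \<Theta> \<Longrightarrow> \<exists>y\<in>F. p (x - y) \<le> e"
proof -
  define Q where "Q F \<longleftrightarrow> finite F \<and> F \<subseteq> \<Theta> \<and> separated e F" for F
  have bound: "real (card F) \<le> (1 + 4 / e) ^ d" if "Q F" for F
    using that \<Theta> e by (intro packing_bound) (auto simp: Q_def)
  have "Q {}" by (simp add: Q_def separated_def)
  moreover have "\<forall>F. Q F \<longrightarrow> card F \<le> nat \<lfloor>(1 + 4 / e) ^ d\<rfloor>"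
    using bound by (auto simp: le_nat_floor)
  ultimately obtain F where F: "Q F" "\<And>G. Q G \<Longrightarrow> card G \<le> card F"
    using ex_has_greatest_nat[of Q "{}" card "Suc (nat \<lfloor>(1 + 4 / e) ^ d\<rfloor>)"] by (auto simp: less_Suc_eq_le)
  have "\<exists>y\<in>F. p (x - y) \<le> e" if x: "x \<in> \<Theta>" for x
  proof (cases "x \<in> F")
    case True then show ?thesis using e zero by (intro bexI[of _ x]) auto
  next
    case False
    show ?thesis
    proof (rule ccontr)
      assume far: "\<not> ?thesis"
      then have "separated e (insert x F)"
        using F(1) \<Theta>(1) x minus_commute unfolding separated_def Q_def
        by (smt (verit) insert_iff subsetD)
      then have "Q (insert x F)" using F(1) x by (auto simp: Q_def)
      from F(2)[OF this] show False using False F(1) by (simp add: Q_def)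
    qed
  qed
  then show thesis using that[of F] F(1) bound[OF F(1)] by (auto simp: Q_def)
qed

end

section \<open>The Minkowski norm of a convex body\<close>

lemma convex_body_coordinate_bound:
  assumes "convex_body d \<Theta>"
  obtains b where "0 < b" "\<And>x i. x \<in> \<Theta> \<Longrightarrow> \<bar>x i\<bar> \<le> b"
proof -
  have \<Theta>: "compact \<Theta>" "\<Theta> \<subseteq> Rspace d" using assms by (auto simp: convex_body_def)
  have "\<exists>c. \<forall>x\<in>\<Theta>. \<bar>x i\<bar> \<le> c" for i
  proof -
    have "compact ((\<lambda>x. x i) ` \<Theta>)"
      using \<Theta>(1) by (intro compact_continuous_image continuous_on_subset[OF continuous_on_product_coordinates]) auto
    then show ?thesis using compact_imp_bounded[of "(\<lambda>x. x i) ` \<Theta>"] by (auto simp: bounded_iff)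
  qed
  then obtain c where c: "\<And>x i. x \<in> \<Theta> \<Longrightarrow> \<bar>x i\<bar> \<le> c i" by metis
  define b where "b = 1 + (\<Sum>i<d. \<bar>c i\<bar>)"
  have "0 < b" by (simp add: b_def sum_nonneg add_pos_nonneg)
  moreover have "\<bar>x i\<bar> \<le> b" if "x \<in> \<Theta>" for x i
  proof (cases "i < d")
    case True
    have "\<bar>c i\<bar> \<le> (\<Sum>i<d. \<bar>c i\<bar>)" using True by (intro member_le_sum) auto
    then show ?thesis using c[OF that, of i] by (simp add: b_def)
  next
    case False
    then have "x i = 0" using that \<Theta>(2) by (auto simp: Rspace_def)
    then show ?thesis using \<open>0 < b\<close> by simp
  qed
  ultimately show thesis by (rule that)
qed

text \<open>In the product topology an interior point has a box as basic neighbourhood. Points of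
  \<open>Rspace d\<close> vary only in the first d coordinates, so one positive side length
  serves.\<close>

lemma convex_body_interior_box:
  assumes "convex_body d \<Theta>"
  obtains x0 e where "0 < e" "x0 \<in> \<Theta>" "\<forall>y\<in>Rspace d. (\<forall>i<d. \<bar>y i\<bar> \<le> e) \<longrightarrow> x0 + y \<in> \<Theta>"
proof -
  have \<Theta>: "\<Theta> \<subseteq> Rspace d" using assms by (simp add: convex_body_def)
  obtain x0 where "x0 \<in> (top_of_set (Rspace d)) interior_of \<Theta>"
    using assms by (auto simp: convex_body_def)
  then obtain U where U: "open U" "x0 \<in> U" "x0 \<in> Rspace d" "Rspace d \<inter> U \<subseteq> \<Theta>"
    by (auto simp: interior_of_def openin_open)
  then have "openin (product_topology (\<lambda>_. euclidean) UNIV) U" by (simp add: open_fun_def)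
  from product_topology_open_contains_basis[OF this U(2)]
  obtain X where X: "x0 \<in> (\<Pi>\<^sub>E i\<in>UNIV. X i)" "\<And>i. open (X i)" "(\<Pi>\<^sub>E i\<in>UNIV. X i) \<subseteq> U" by auto
  have "\<exists>e>0. \<forall>t. \<bar>t\<bar> \<le> e \<longrightarrow> x0 i + t \<in> X i" for i
  proof -
    have "x0 i \<in> X i" using X(1) by auto
    then obtain e where "0 < e" "cball (x0 i) e \<subseteq> X i" using X(2) open_contains_cball by blast
    then show ?thesis by (intro exI[of _ e]) (auto simp: subset_iff dist_real_def)
  qed
  then obtain r where r: "\<And>i. 0 < r i" "\<And>i t. \<bar>t\<bar> \<le> r i \<Longrightarrow> x0 i + t \<in> X i" by metis
  \<comment> \<open>Inserting 1 keeps the minimum defined for d = 0.\<close>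
  define e where "e = Min (insert 1 (r ` {..<d}))"
  have e: "0 < e" "\<And>i. i < d \<Longrightarrow> e \<le> r i" using r(1) by (auto simp: e_def)
  have "x0 + y \<in> \<Theta>" if y: "y \<in> Rspace d" "\<And>i. i < d \<Longrightarrow> \<bar>y i\<bar> \<le> e" for y
  proof -
    have "\<bar>y i\<bar> \<le> r i" for i
      using y e(2)[of i] r(1)[of i] by (cases "i < d") (force simp: Rspace_def)+
    then have "x0 + y \<in> (\<Pi>\<^sub>E i\<in>UNIV. X i)" using r(2) by auto
    then show ?thesis using X(3) U(3,4) y(1) Rspace_closed(2) by blast
  qed
  moreover have "x0 \<in> \<Theta>" using U by auto
  ultimately show thesis using that e(1) by blast
qed

section \<open>Minkowski functionals of convex sets\<close>

context
  fixes K :: "'a::real_vector set"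
begin

text \<open>This is \<open>Theta_norm\<close> with the symmetric hull replaced by an arbitrary K, so
  that subadditivity rests on convexity alone.\<close>

definition minkowski :: "'a \<Rightarrow> real" where
  "minkowski x = Inf {l. 0 < l \<and> x \<in> (\<lambda>y. l *\<^sub>R y) ` K}"

lemma minkowski_le: "0 < l \<Longrightarrow> y \<in> K \<Longrightarrow> minkowski (l *\<^sub>R y) \<le> l"
  unfolding minkowski_def by (rule cInf_lower) (auto intro!: bdd_belowI[of _ 0])

text \<open>The first premise says that some positive multiple of K contains x; otherwise the
  infimum is over the empty set and carries no information.\<close>

lemma minkowski_greatest:
  assumes "\<exists>l>0. \<exists>y\<in>K. x = l *\<^sub>R y" "\<And>l y. 0 < l \<Longrightarrow> y \<in> K \<Longrightarrow> x = l *\<^sub>R y \<Longrightarrow> m \<le> l"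
  shows "m \<le> minkowski x"
  unfolding minkowski_def using assms by (intro cInf_greatest) auto

lemma minkowski_add:
  assumes "convex K" "\<exists>l>0. \<exists>y\<in>K. x = l *\<^sub>R y" "\<exists>l>0. \<exists>y\<in>K. x' = l *\<^sub>R y"
  shows "minkowski (x + x') \<le> minkowski x + minkowski x'"
proof -
  have "minkowski (x + x') \<le> l + l'"
    if "0 < l" "y \<in> K" "x = l *\<^sub>R y" "0 < l'" "y' \<in> K" "x' = l' *\<^sub>R y'" for l l' y y'
  proof -
    \<comment> \<open>x + x' is l + l' times the convex combination of y and y' with weights
      proportional to l and l'.\<close>
    define z where "z = (l / (l + l')) *\<^sub>R y + (l' / (l + l')) *\<^sub>R y'"
    have "z \<in> K" unfolding z_def using that assms(1)
      by (intro convexD) (auto simp: add_divide_distrib[symmetric])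
    moreover have "(l + l') *\<^sub>R z = x + x'" using that by (simp add: z_def scaleR_add_right)
    ultimately show ?thesis using minkowski_le[of "l + l'" z] that by simp
  qed
  \<comment> \<open>The two infima are taken one after the other, the first with the scale l'
    fixed.\<close>
  then have "minkowski (x + x') - l' \<le> minkowski x"
    if "0 < l'" "y' \<in> K" "x' = l' *\<^sub>R y'" for l' y'
    using that by (intro minkowski_greatest assms) (auto simp: algebra_simps)
  then have "minkowski (x + x') - minkowski x \<le> minkowski x'"
    by (intro minkowski_greatest assms) (auto simp: algebra_simps)
  then show ?thesis by simp
qed

lemma minkowski_scale_pos:
  assumes "\<exists>l>0. \<exists>y\<in>K. x = l *\<^sub>R y" "0 < r"
  shows "minkowski (r *\<^sub>R x) \<le> r * minkowski x"
proof -
  have "minkowski (r *\<^sub>R x) / r \<le> l" if "0 < l" "y \<in> K" "x = l *\<^sub>R y" for l y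
    using minkowski_le[of "r * l" y] that assms(2) by (simp add: field_simps)
  then have "minkowski (r *\<^sub>R x) / r \<le> minkowski x" by (intro minkowski_greatest assms)
  then show ?thesis using assms(2) by (simp add: field_simps)
qed

end

lemma Theta_norm_eq_minkowski: "Theta_norm \<Theta> = minkowski (convex hull (\<Theta> \<union> uminus ` \<Theta>))"
  by (simp add: Theta_norm_def minkowski_def fun_eq_iff)

lemma symmetric_hull_uminus:
  fixes \<Theta> :: "'a::real_vector set"
  assumes "y \<in> convex hull (\<Theta> \<union> uminus ` \<Theta>)"
  shows "- y \<in> convex hull (\<Theta> \<union> uminus ` \<Theta>)"
proof -
  have "uminus ` (convex hull (\<Theta> \<union> uminus ` \<Theta>)) = convex hull (uminus ` (\<Theta> \<union> uminus ` \<Theta>))"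
    by (rule convex_hull_linear_image) (simp add: linear_iff)
  also have "uminus ` (\<Theta> \<union> uminus ` \<Theta>) = \<Theta> \<union> uminus ` \<Theta>" by (auto simp: image_Un image_image)
  finally show ?thesis using assms by blast
qed

lemma Theta_norm_le_1: "x \<in> \<Theta> \<Longrightarrow> Theta_norm \<Theta> x \<le> 1"
  using minkowski_le[of 1 x "convex hull (\<Theta> \<union> uminus ` \<Theta>)"]
  by (simp add: Theta_norm_eq_minkowski hull_inc)

lemma Theta_norm_equivalent_seminorm:
  assumes "convex_body d \<Theta>"
  obtains b B where "equivalent_seminorm d (Theta_norm \<Theta>) b B"
proof -
  define K where "K = convex hull (\<Theta> \<union> uminus ` \<Theta>)"
  have K: "convex K" "\<Theta> \<subseteq> K" "\<And>y. y \<in> K \<Longrightarrow> - y \<in> K"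
    by (auto simp: K_def convex_convex_hull hull_inc intro: symmetric_hull_uminus)
  have N: "Theta_norm \<Theta> = minkowski K" by (simp add: Theta_norm_eq_minkowski K_def)
  obtain b where b: "0 < b" "\<And>x i. x \<in> \<Theta> \<Longrightarrow> \<bar>x i\<bar> \<le> b"
    using convex_body_coordinate_bound[OF assms] by blast
  \<comment> \<open>This cube contains \<open>\<Theta>\<close> and its reflection, so by convexity
    it contains K.\<close>
  have "convex {y::nat \<Rightarrow> real. \<forall>i. \<bar>y i\<bar> \<le> b}"
  proof (rule convexI, clarify)
    fix x y :: "nat \<Rightarrow> real" and u v :: real and i
    assume a: "\<forall>i. \<bar>x i\<bar> \<le> b" "\<forall>i. \<bar>y i\<bar> \<le> b" "0 \<le> u" "0 \<le> v" "u + v = 1"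
    have "\<bar>u * x i + v * y i\<bar> \<le> u * \<bar>x i\<bar> + v * \<bar>y i\<bar>"
      using a by (metis abs_mult abs_of_nonneg abs_triangle_ineq)
    also have "\<dots> \<le> u * b + v * b" using a by (intro add_mono mult_left_mono) auto
    also have "\<dots> = b" using a by (metis distrib_right mult_1)
    finally show "\<bar>(u *\<^sub>R x + v *\<^sub>R y) i\<bar> \<le> b" by (simp add: scaleR_fun_def)
  qed
  then have Kb: "\<bar>y i\<bar> \<le> b" if "y \<in> K" for y i
    using hull_minimal[of "\<Theta> \<union> uminus ` \<Theta>" "{y. \<forall>i. \<bar>y i\<bar> \<le> b}" convex] b(2) that
    unfolding K_def by fastforce
  obtain x0 e where e: "0 < e" "x0 \<in> \<Theta>" "\<forall>y\<in>Rspace d. (\<forall>i<d. \<bar>y i\<bar> \<le> e) \<longrightarrow> x0 + y \<in> \<Theta>"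
    using convex_body_interior_box[OF assms] by blast
  \<comment> \<open>Averaging \<open>x0 + y\<close> with \<open>- x0\<close> moves the box around x0
    to the origin at half the size; this is the origin of 2 / e.\<close>
  have box: "\<exists>y\<in>K. x = (2 / e * \<delta>) *\<^sub>R y" if x: "x \<in> Rspace d" "0 < \<delta>" "\<And>i. i < d \<Longrightarrow> \<bar>x i\<bar> \<le> \<delta>" for x \<delta>
  proof -
    define y where "y = (e / \<delta>) *\<^sub>R x"
    have "x0 + y \<in> \<Theta>" using x e(1)
      by (intro e(3)[rule_format]) (auto simp: y_def scaleR_fun_def abs_mult field_simps Rspace_def)
    then have "(1/2) *\<^sub>R (x0 + y) + (1/2) *\<^sub>R (- x0) \<in> K"
      using K e(2) by (intro convexD) auto
    moreover have "(1/2) *\<^sub>R (x0 + y) + (1/2) *\<^sub>R (- x0) = (1/2) *\<^sub>R y" by (simp add: algebra_simps)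
    moreover have "x = (2 / e * \<delta>) *\<^sub>R ((1/2) *\<^sub>R y)" using e(1) x(2) by (simp add: y_def)
    ultimately show ?thesis by metis
  qed
  have ex: "\<exists>l>0. \<exists>y\<in>K. x = l *\<^sub>R y" if x: "x \<in> Rspace d" for x
  proof -
    define \<delta> where "\<delta> = 1 + (\<Sum>i<d. \<bar>x i\<bar>)"
    have "0 < \<delta>" by (simp add: \<delta>_def sum_nonneg add_pos_nonneg)
    moreover have "\<bar>x i\<bar> \<le> \<delta>" if "i < d" for i
      using member_le_sum[of i "{..<d}" "\<lambda>i. \<bar>x i\<bar>"] that by (simp add: \<delta>_def)
    ultimately show ?thesis using box[OF x, of \<delta>] e(1) by (intro exI[of _ "2 / e * \<delta>"]) auto
  qed
  have nonneg: "0 \<le> minkowski K x" if "x \<in> Rspace d" for x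
    using ex[OF that] by (rule minkowski_greatest) simp
  have zero: "minkowski K 0 = 0"
  proof (rule antisym)
    obtain y where "y \<in> K" "0 = (2 / e * 1) *\<^sub>R y" using box[of 0 1] Rspace_closed(1)[of d] by auto
    then have "0 \<in> K" using e(1) by (metis divide_eq_0_iff less_irrefl mult_1_right scaleR_eq_0_iff zero_neq_numeral)
    then have "minkowski K 0 \<le> l" if "0 < l" for l using minkowski_le[of l 0 K] that by simp
    then show "minkowski K 0 \<le> 0" by (rule field_le_epsilon[of _ 0, simplified])
  qed (rule nonneg, rule Rspace_closed)
  have pos: "minkowski K (r *\<^sub>R x) = r * minkowski K x" if "x \<in> Rspace d" "0 < r" for x r
  proof (rule antisym)
    show "minkowski K (r *\<^sub>R x) \<le> r * minkowski K x" by (rule minkowski_scale_pos[OF ex[OF that(1)] that(2)])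
    \<comment> \<open>The inequality for the inverse factor gives the reverse direction.\<close>
    have "minkowski K ((1 / r) *\<^sub>R (r *\<^sub>R x)) \<le> (1 / r) * minkowski K (r *\<^sub>R x)"
      using that by (intro minkowski_scale_pos ex Rspace_closed) auto
    then show "r * minkowski K x \<le> minkowski K (r *\<^sub>R x)" using that by (simp add: field_simps)
  qed
  have neg: "minkowski K (- x) = minkowski K x" for x
  proof -
    have "x \<in> (\<lambda>y. l *\<^sub>R y) ` K" if x: "- x \<in> (\<lambda>y. l *\<^sub>R y) ` K" for x l
    proof -
      obtain y where "y \<in> K" "- x = l *\<^sub>R y" using x by blast
      then show ?thesis using K(3)[of y] by (metis image_eqI minus_minus scaleR_minus_right)
    qed
    then have "- x \<in> (\<lambda>y. l *\<^sub>R y) ` K \<longleftrightarrow> x \<in> (\<lambda>y. l *\<^sub>R y) ` K" for l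
      by (metis minus_minus)
    then show ?thesis by (simp add: minkowski_def)
  qed
  have scale: "minkowski K (r *\<^sub>R x) = \<bar>r\<bar> * minkowski K x" if "x \<in> Rspace d" for r x
  proof -
    consider "r = 0" | "0 < r" | "0 < - r" by linarith
    then show ?thesis
    proof cases
      case 1 then show ?thesis using zero by simp
    next
      case 2 then show ?thesis using pos that by simp
    next
      case 3
      have "minkowski K (r *\<^sub>R x) = minkowski K ((- r) *\<^sub>R x)" using neg[of "r *\<^sub>R x"] by simp
      then show ?thesis using pos[OF that 3] 3 by simp
    qed
  qed
  have "equivalent_seminorm d (minkowski K) b (2 / e)"
  proof
    show "minkowski K (x + y) \<le> minkowski K x + minkowski K y" if "x \<in> Rspace d" "y \<in> Rspace d" for x y
      by (intro minkowski_add K ex that)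
    show "minkowski K x \<le> 2 / e * \<delta>" if x: "x \<in> Rspace d" "0 < \<delta>" "\<And>i. i < d \<Longrightarrow> \<bar>x i\<bar> \<le> \<delta>" for x \<delta>
      using box[OF x] minkowski_le[of "2 / e * \<delta>" _ K] x(2) e(1) by (metis divide_pos_pos mult_pos_pos zero_less_numeral)
    show "\<bar>x i\<bar> \<le> b * minkowski K x" if "x \<in> Rspace d" for x i
    proof -
      have "\<bar>x i\<bar> / b \<le> minkowski K x"
      proof (rule minkowski_greatest[OF ex[OF that]])
        fix l y assume l: "0 < l" "y \<in> K" "x = l *\<^sub>R y"
        have "\<bar>x i\<bar> = l * \<bar>y i\<bar>" using l by (simp add: scaleR_fun_def abs_mult)
        also have "\<dots> \<le> l * b" using Kb[OF l(2), of i] l(1) by simp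
        finally show "\<bar>x i\<bar> / b \<le> l" using b(1) by (simp add: field_simps)
      qed
      then show ?thesis using b(1) by (simp add: field_simps)
    qed
  qed (use nonneg scale b(1) e(1) in auto)
  then show thesis using that N by metis
qed

section \<open>Chaining\<close>

text \<open>Being an infimum, the norm directly yields the moment bound at every strictly larger
  scale, by monotonicity in the scale. The gap is paid for later by scales with factor 3 against
  lengths with factor 2.\<close>

lemma psi2_norm_bound:
  assumes "psi2_norm M X \<le> ereal s" "s < t" "0 < t"
  shows "(\<integral>\<^sup>+ w. ennreal (exp ((X w / t)\<^sup>2)) \<partial>M) \<le> 2"
proof -
  have "psi2_norm M X < ereal t" using assms by (meson ereal_less(2) le_less_trans less_ereal.simps(1))
  then obtain t' where t': "0 < t'" "t' < t" "(\<integral>\<^sup>+ w. ennreal (exp ((X w)\<^sup>2 / t'\<^sup>2)) \<partial>M) \<le> 2"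
    by (auto simp: psi2_norm_def Inf_less_iff)
  have "(\<integral>\<^sup>+ w. ennreal (exp ((X w / t)\<^sup>2)) \<partial>M) \<le> (\<integral>\<^sup>+ w. ennreal (exp ((X w)\<^sup>2 / t'\<^sup>2)) \<partial>M)"
    using t' by (intro nn_integral_mono ennreal_leI)
      (auto simp: power_divide intro!: divide_left_mono power_mono)
  then show ?thesis using t'(3) by simp
qed

text \<open>
  Since \<open>1 + y \<le> exp y\<close>, \<open>soft_max\<close> dominates the maximum of the \<open>q p\<close>, and its expectation is at most
  \<open>L + 1\<close> as soon as \<open>exp L\<close> dominates the sum of the exponential moments.
\<close>

definition soft_max :: "'i set \<Rightarrow> real \<Rightarrow> ('i \<Rightarrow> 'w \<Rightarrow> real) \<Rightarrow> 'w \<Rightarrow> real" where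
  "soft_max P L q w = L + (\<Sum>p\<in>P. exp (q p w - L))"

lemma soft_max_nonneg: "0 \<le> L \<Longrightarrow> 0 \<le> soft_max P L q w"
  by (simp add: soft_max_def sum_nonneg)

lemma soft_max_upper:
  assumes "finite P" "p \<in> P"
  shows "q p w \<le> soft_max P L q w"
proof -
  have "q p w - L \<le> exp (q p w - L)" using exp_ge_add_one_self[of "q p w - L"] by linarith
  also have "\<dots> \<le> (\<Sum>p\<in>P. exp (q p w - L))" using assms by (intro member_le_sum) auto
  finally show ?thesis by (simp add: soft_max_def)
qed

lemma soft_max_measurable [measurable]:
  assumes [measurable]: "\<And>p. p \<in> P \<Longrightarrow> q p \<in> borel_measurable M"
  shows "soft_max P L q \<in> borel_measurable M"
  unfolding soft_max_def[abs_def]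
  by (intro borel_measurable_add borel_measurable_const borel_measurable_sum) measurable

lemma (in prob_space) nn_integral_soft_max:
  assumes "finite P" "\<And>p. p \<in> P \<Longrightarrow> q p \<in> borel_measurable M"
    and "\<And>p. p \<in> P \<Longrightarrow> (\<integral>\<^sup>+ w. ennreal (exp (q p w)) \<partial>M) \<le> ennreal c"
    and "real (card P) * c \<le> exp L" "0 \<le> L" "0 \<le> c"
  shows "(\<integral>\<^sup>+ w. ennreal (soft_max P L q w) \<partial>M) \<le> ennreal (L + 1)"
proof -
  note assms(2)[measurable]
  have "(\<integral>\<^sup>+ w. ennreal (soft_max P L q w) \<partial>M)
      = (\<integral>\<^sup>+ w. ennreal L + (\<Sum>p\<in>P. ennreal (exp (- L)) * ennreal (exp (q p w))) \<partial>M)"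
    using assms(5) by (intro nn_integral_cong)
      (simp add: soft_max_def sum_nonneg exp_diff exp_minus field_simps flip: ennreal_mult)
  also have "\<dots> = ennreal L + (\<Sum>p\<in>P. ennreal (exp (- L)) * (\<integral>\<^sup>+ w. ennreal (exp (q p w)) \<partial>M))"
    by (simp add: nn_integral_add nn_integral_sum nn_integral_cmult emeasure_space_1)
  also have "\<dots> \<le> ennreal L + (\<Sum>p\<in>P. ennreal (exp (- L)) * ennreal c)"
    by (intro add_left_mono sum_mono mult_left_mono assms) auto
  also have "\<dots> = ennreal (L + exp (- L) * (real (card P) * c))"
    using assms(5,6) by (simp add: ennreal_of_nat_eq_real_of_nat ennreal_mult[symmetric] ennreal_plus[symmetric] mult_ac del: ennreal_plus)
  also have "\<dots> \<le> ennreal (L + exp (- L) * exp L)"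
    using assms(4) by (intro ennreal_leI add_left_mono mult_left_mono) auto
  finally show ?thesis by (simp add: exp_minus)
qed

text \<open>By monotone convergence the series has finite integral, so it is finite almost
  everywhere. The last premise bounds partial sums, the form that \<open>level_weight_sum_le\<close>
  delivers.\<close>

lemma AE_summable_of_nn_integral:
  fixes f :: "nat \<Rightarrow> 'a \<Rightarrow> real"
  assumes [measurable]: "\<And>k. f k \<in> borel_measurable M" and "\<And>k w. 0 \<le> f k w"
    and "\<And>k. (\<integral>\<^sup>+ w. ennreal (f k w) \<partial>M) \<le> ennreal (c k)" "\<And>k. 0 \<le> c k" "\<And>K. (\<Sum>k<K. c k) \<le> C"
  shows "AE w in M. summable (\<lambda>k. f k w)"
proof -
  have "(\<integral>\<^sup>+ w. (\<Sum>k. ennreal (f k w)) \<partial>M) = (\<Sum>k. \<integral>\<^sup>+ w. ennreal (f k w) \<partial>M)"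
    by (intro nn_integral_suminf) measurable
  also have "\<dots> \<le> (\<Sum>k. ennreal (c k))" by (intro suminf_le assms summableI)
  also have "\<dots> \<le> ennreal C"
    unfolding suminf_eq_SUP using assms(4,5) by (intro SUP_least) (simp add: sum_ennreal ennreal_leI)
  finally have "(\<integral>\<^sup>+ w. (\<Sum>k. ennreal (f k w)) \<partial>M) \<noteq> \<infinity>" using ennreal_less_top[of C] by (auto simp: top_unique)
  then have "AE w in M. (\<Sum>k. ennreal (f k w)) \<noteq> \<infinity>" by (intro nn_integral_PInf_AE) auto
  then show ?thesis
    by (rule AE_mp) (auto intro!: AE_I2 summable_suminf_not_top assms)
qed

lemma abs_le_one_plus_square: "\<bar>x\<bar> \<le> 1 + x\<^sup>2" for x :: real
  using sum_squares_ge_zero[of "\<bar>x\<bar> - 1" 0] zero_le_power2[of x] by (auto simp: power2_eq_square algebra_simps)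

text \<open>The series of (1/2) ^ k and of k * (1/2) ^ k both have value 2, so the coefficient of b
  tends to 2 * 2 + 7 * 2 = 18. The explicit remainder makes the induction close.\<close>

lemma level_weight_sum:
  "(\<Sum>k<K. (1/2) ^ k * (a + (2 * real k + 7) * b)) = 2 * a + 18 * b - (1/2) ^ K * (2 * a + (4 * real K + 18) * b)"
proof (induction K)
  case (Suc K)
  have "(1/2) ^ K * (a + (2 * real K + 7) * b)
      = (1/2) ^ K * (2 * a + (4 * real K + 18) * b) - (1/2) ^ Suc K * (2 * a + (4 * real (Suc K) + 18) * b)"
    by (simp add: algebra_simps)
  then show ?case using Suc by simp
qed simp

lemma level_weight_sum_le:
  fixes a b :: real assumes "0 \<le> a" "0 \<le> b"
  shows "(\<Sum>k<K. (1/2) ^ k * (a + (2 * real k + 7) * b)) \<le> 2 * a + 18 * b"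
  unfolding level_weight_sum using assms by simp

text \<open>Cauchy-Schwarz with weights (1/2) ^ k of total at most 2, then (x + V)^2 <= 3 x^2 +
  (3/2) V^2. The factor 2 ^ k is affordable because squared increments of level k have size of order
  (1/4) ^ k, so the product still decays geometrically.\<close>

lemma weighted_chain_square:
  fixes x :: real
  shows "(x + (\<Sum>k<K. v k))\<^sup>2 \<le> 3 * (x\<^sup>2 + (\<Sum>k<K. 2 ^ k * (v k)\<^sup>2))"
proof -
  define V where "V = (\<Sum>k<K. v k)"
  have "V = (\<Sum>k<K. sqrt ((1/2) ^ k) * (sqrt (2 ^ k) * v k))"
    unfolding V_def by (intro sum.cong) (auto simp: real_sqrt_mult[symmetric] power_mult_distrib[symmetric] mult.assoc[symmetric])
  then have "V\<^sup>2 \<le> (\<Sum>k<K. (sqrt ((1/2) ^ k))\<^sup>2) * (\<Sum>k<K. (sqrt (2 ^ k) * v k)\<^sup>2)"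
    using Cauchy_Schwarz_ineq_sum[of "\<lambda>k. sqrt ((1/2) ^ k)"] by simp
  also have "\<dots> = (\<Sum>k<K. (1/2) ^ k) * (\<Sum>k<K. 2 ^ k * (v k)\<^sup>2)" by (simp add: power_mult_distrib)
  also have "\<dots> \<le> 2 * (\<Sum>k<K. 2 ^ k * (v k)\<^sup>2)"
    using geometric_sum[of "1/2::real" K] by (intro mult_right_mono sum_nonneg) auto
  finally have "V\<^sup>2 \<le> 2 * (\<Sum>k<K. 2 ^ k * (v k)\<^sup>2)" .
  moreover have "(x + V)\<^sup>2 \<le> 3 * x\<^sup>2 + 3 / 2 * V\<^sup>2"
    using sum_squares_ge_zero[of "2 * x - V" 0] by (simp add: power2_eq_square algebra_simps)
  ultimately show ?thesis unfolding V_def by (simp add: algebra_simps)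
qed

text \<open>Convergence in the product topology is coordinatewise, and on \<open>Rspace d\<close>
  finitely many coordinates control p.\<close>

lemma (in equivalent_seminorm) tendsto_norm_diff:
  assumes "s \<longlonglongrightarrow> \<theta>" "\<And>k. s k \<in> Rspace d" "\<theta> \<in> Rspace d" "0 < e"
  shows "\<forall>\<^sub>F k in sequentially. p (s k - \<theta>) \<le> e"
proof -
  define \<delta> where "\<delta> = e / B"
  have \<delta>: "0 < \<delta>" using assms(4) B_pos by (simp add: \<delta>_def)
  have "(\<lambda>k. s k i) \<longlonglongrightarrow> \<theta> i" for i
    using continuous_on_tendsto_compose[OF continuous_on_product_coordinates assms(1)] by auto
  then have "\<forall>\<^sub>F k in sequentially. dist (s k i) (\<theta> i) < \<delta>" for i
    using \<delta> by (auto simp: tendsto_iff)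
  then have "\<forall>\<^sub>F k in sequentially. \<bar>s k i - \<theta> i\<bar> \<le> \<delta>" for i
    unfolding dist_real_def by (rule eventually_mono) (rule less_imp_le)
  then have "\<forall>\<^sub>F k in sequentially. \<forall>i\<in>{..<d}. \<bar>s k i - \<theta> i\<bar> \<le> \<delta>" by (intro eventually_ball_finite) auto
  then show ?thesis
  proof eventually_elim
    case (elim k)
    have "p (s k - \<theta>) \<le> B * \<delta>" using elim assms \<delta> by (intro le_coord) (auto intro: Rspace_closed)
    then show ?case using B_pos by (simp add: \<delta>_def)
  qed
qed

section \<open>Nets of dyadic radius and their links\<close>

locale net_sequence = equivalent_seminorm +
  fixes \<Theta> :: "(nat \<Rightarrow> real) set" and N :: "nat \<Rightarrow> (nat \<Rightarrow> real) set" and proj :: "nat \<Rightarrow> (nat \<Rightarrow> real) \<Rightarrow> nat \<Rightarrow> real"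
  assumes \<Theta>_Rspace: "\<Theta> \<subseteq> Rspace d"
    and finite_N: "finite (N k)" and N_sub: "N k \<subseteq> \<Theta>" and card_N: "card (N k) \<le> 2 ^ ((k + 3) * d)"
    and proj_N: "\<theta> \<in> \<Theta> \<Longrightarrow> proj k \<theta> \<in> N k" and proj_close: "\<theta> \<in> \<Theta> \<Longrightarrow> p (\<theta> - proj k \<theta>) \<le> (1/2) ^ k"
begin

definition links :: "nat \<Rightarrow> ((nat \<Rightarrow> real) \<times> (nat \<Rightarrow> real)) set" where
  "links k = {(s, t) \<in> N k \<times> N (Suc k). p (s - t) \<le> 2 * (1/2) ^ k}"

lemma finite_links: "finite (links k)"
  unfolding links_def by (rule finite_subset[of _ "N k \<times> N (Suc k)"]) (auto simp: finite_N)

lemma card_links: "card (links k) \<le> 2 ^ ((2 * k + 7) * d)"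
proof -
  have "card (links k) \<le> card (N k \<times> N (Suc k))"
    unfolding links_def by (intro card_mono) (auto simp: finite_N)
  also have "\<dots> \<le> 2 ^ ((k + 3) * d) * 2 ^ ((Suc k + 3) * d)"
    unfolding card_cartesian_product by (intro mult_mono card_N) auto
  finally show ?thesis by (simp add: power_add[symmetric] algebra_simps)
qed

lemma links_\<Theta>: "(s, t) \<in> links k \<Longrightarrow> s \<in> \<Theta> \<and> t \<in> \<Theta> \<and> p (s - t) < 3 * (1/2) ^ k"
  using N_sub by (force simp: links_def intro: le_less_trans)

lemma proj_\<Theta>: "\<theta> \<in> \<Theta> \<Longrightarrow> proj k \<theta> \<in> \<Theta>"
  using proj_N N_sub by blast

text \<open>The two base points may differ: a sequence approaching \<open>\<theta>\<close> is later
  compared with \<open>\<theta>\<close> itself one level finer. Their distance and the two net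
  errors add up to 2 * (1/2) ^ k, the length allowed for links.\<close>

lemma proj_link:
  assumes "\<theta> \<in> \<Theta>" "\<theta>' \<in> \<Theta>" "p (\<theta> - \<theta>') \<le> (1/2) ^ Suc k"
  shows "(proj k \<theta>, proj (Suc k) \<theta>') \<in> links k"
proof -
  have R: "\<theta> \<in> Rspace d" "\<theta>' \<in> Rspace d" "proj k \<theta> \<in> Rspace d" "proj (Suc k) \<theta>' \<in> Rspace d"
    using assms proj_\<Theta> \<Theta>_Rspace by auto
  have "p (proj k \<theta> - proj (Suc k) \<theta>') \<le> p (proj k \<theta> - \<theta>) + (p (\<theta> - \<theta>') + p (\<theta>' - proj (Suc k) \<theta>'))"
    using triangle_via[OF R(3,1,4)] triangle_via[OF R(1,2,4)] by simp
  also have "\<dots> \<le> (1/2) ^ k + ((1/2) ^ Suc k + (1/2) ^ Suc k)"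
    using proj_close[OF assms(1), of k] minus_commute[OF R(3,1)] proj_close[OF assms(2), of "Suc k"] assms(3)
    by (intro add_mono) auto
  finally show ?thesis using assms proj_N by (simp add: links_def)
qed

end

text \<open>As 2 <= e, the logarithm of \<open>m * 2 ^ n\<close> is at most n + a; such sums are the
  levels L at which \<open>soft_max\<close> is used.\<close>

lemma two_power_mult_le_exp: "real m \<le> 2 ^ a \<Longrightarrow> real m * 2 ^ n \<le> exp (real n + real a)"
proof -
  assume "real m \<le> 2 ^ a"
  then have "real m * 2 ^ n \<le> 2 ^ a * 2 ^ n" by simp
  also have "\<dots> = 2 ^ (n + a)" by (simp add: power_add)
  also have "\<dots> \<le> exp 1 ^ (n + a)" using exp_ge_add_one_self[of "1::real"] by (intro power_mono) auto
  also have "\<dots> = exp (real n + real a)" by (simp add: exp_of_nat_mult[symmetric])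
  finally show ?thesis .
qed

lemma (in equivalent_seminorm) net_sequence_exists:
  assumes \<Theta>: "\<Theta> \<subseteq> Rspace d" "\<And>x. x \<in> \<Theta> \<Longrightarrow> p x \<le> 1"
  obtains N proj where "net_sequence d p b B \<Theta> N proj"
proof -
  have "\<exists>F. finite F \<and> F \<subseteq> \<Theta> \<and> card F \<le> 2 ^ ((k + 3) * d) \<and> (\<forall>x\<in>\<Theta>. \<exists>y\<in>F. p (x - y) \<le> (1/2) ^ k)" for k
  proof -
    obtain F where F: "finite F" "F \<subseteq> \<Theta>" "real (card F) \<le> (1 + 4 / (1/2) ^ k) ^ d"
      "\<And>x. x \<in> \<Theta> \<Longrightarrow> \<exists>y\<in>F. p (x - y) \<le> (1/2) ^ k"
      using finite_net[OF \<Theta>, of "(1/2) ^ k"] by (auto simp: power_le_one)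
    \<comment> \<open>1 + 4 * 2 ^ k is at most 8 * 2 ^ k, whence the exponent k + 3.\<close>
    have "1 \<le> 4 * (2::real) ^ k" using one_le_power[of "2::real" k] by linarith
    then have "1 + 4 / (1/2) ^ k \<le> (2::real) ^ (k + 3)" by (simp add: power_add power_one_over)
    then have "(1 + 4 / (1/2) ^ k) ^ d \<le> ((2::real) ^ (k + 3)) ^ d" by (intro power_mono) auto
    then have "real (card F) \<le> 2 ^ ((k + 3) * d)" using F(3) unfolding power_mult by linarith
    then have "card F \<le> 2 ^ ((k + 3) * d)" by (metis of_nat_le_iff of_nat_numeral of_nat_power)
    with F show ?thesis by blast
  qed
  then have "\<exists>N. \<forall>k. finite (N k) \<and> N k \<subseteq> \<Theta> \<and> card (N k) \<le> 2 ^ ((k + 3) * d) \<and> (\<forall>x\<in>\<Theta>. \<exists>y\<in>N k. p (x - y) \<le> (1/2) ^ k)"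
    by (intro choice allI)
  then obtain N where N: "\<forall>k. finite (N k) \<and> N k \<subseteq> \<Theta> \<and> card (N k) \<le> 2 ^ ((k + 3) * d) \<and> (\<forall>x\<in>\<Theta>. \<exists>y\<in>N k. p (x - y) \<le> (1/2) ^ k)"
    by (rule exE)
  define proj where "proj k x = (SOME y. y \<in> N k \<and> p (x - y) \<le> (1/2) ^ k)" for k x
  have "proj k x \<in> N k \<and> p (x - proj k x) \<le> (1/2) ^ k" if "x \<in> \<Theta>" for k x
  proof -
    have "\<exists>y. y \<in> N k \<and> p (x - y) \<le> (1/2) ^ k" using N that by blast
    from someI_ex[OF this] show ?thesis unfolding proj_def .
  qed
  then have "net_sequence d p b B \<Theta> N proj"
    by unfold_locales (use N \<Theta>(1) in blast)+
  then show thesis by (rule that)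
qed

text \<open>The subgaussian conditions as moment bounds at strictly larger scales: links of level k
  have length at most 2 * (1/2) ^ k and are measured at scale 3 * (1/2) ^ k, single values at scale
  3 since the diameter is at most 2.\<close>

locale subgaussian_chain = net_sequence + prob_space +
  fixes X :: "(nat \<Rightarrow> real) \<Rightarrow> 'a \<Rightarrow> real"
  assumes X_measurable: "s \<in> \<Theta> \<Longrightarrow> X s \<in> borel_measurable M"
    and increment: "s \<in> \<Theta> \<Longrightarrow> t \<in> \<Theta> \<Longrightarrow> p (s - t) < \<tau> \<Longrightarrow>
      (\<integral>\<^sup>+ w. ennreal (exp (((X s w - X t w) / \<tau>)\<^sup>2)) \<partial>M) \<le> 2"
    and single: "s \<in> \<Theta> \<Longrightarrow> (\<integral>\<^sup>+ w. ennreal (exp ((X s w / 3)\<^sup>2)) \<partial>M) \<le> 2"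
    and separable: "separable_process \<Theta> M X"
begin

section \<open>Pathwise convergence along the nets\<close>

definition scale_at :: "nat \<Rightarrow> real" where "scale_at k = 3 * (1/2) ^ k"

lemma scale_at_pos: "0 < scale_at k"
  by (simp add: scale_at_def)

definition ratio_sq :: "nat \<Rightarrow> (nat \<Rightarrow> real) \<times> (nat \<Rightarrow> real) \<Rightarrow> 'a \<Rightarrow> real" where
  "ratio_sq k q w = ((X (fst q) w - X (snd q) w) / scale_at k)\<^sup>2"

lemma ratio_sq_measurable: "q \<in> links k \<Longrightarrow> ratio_sq k q \<in> borel_measurable M"
  unfolding ratio_sq_def[abs_def] using links_\<Theta>[of "fst q" "snd q" k]
  by (intro borel_measurable_power borel_measurable_divide borel_measurable_diff borel_measurable_const X_measurable) auto

lemma nn_integral_exp_ratio_sq: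
  assumes "q \<in> links k" shows "(\<integral>\<^sup>+ w. ennreal (exp (ratio_sq k q w)) \<partial>M) \<le> 2"
  unfolding ratio_sq_def using links_\<Theta>[of "fst q" "snd q" k] assms
  by (intro increment) (auto simp: scale_at_def)

lemma card_links_real: "real (card (links k)) \<le> 2 ^ ((2 * k + 7) * d)"
  using card_links[of k] by (metis of_nat_le_iff of_nat_numeral of_nat_power)

text \<open>A bound on all level-k increments of one path at once. Convergence of a path needs the
  increments themselves to be summable, not their squares; the passage is
  \<open>abs_le_one_plus_square\<close>, which contributes the 1 in front of
  \<open>soft_max\<close>.\<close>

definition increment_bound :: "nat \<Rightarrow> 'a \<Rightarrow> real" where
  "increment_bound k w = scale_at k * (1 + soft_max (links k) (real 1 + real ((2 * k + 7) * d)) (ratio_sq k) w)"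

lemma increment_bound_nonneg: "0 \<le> increment_bound k w"
  unfolding increment_bound_def using scale_at_pos[of k]
  by (intro mult_nonneg_nonneg add_nonneg_nonneg soft_max_nonneg) auto

lemma increment_bound_upper:
  assumes "(s, t) \<in> links k"
  shows "\<bar>X s w - X t w\<bar> \<le> increment_bound k w"
proof -
  define x where "x = (X s w - X t w) / scale_at k"
  have "\<bar>x\<bar> \<le> 1 + x\<^sup>2" by (rule abs_le_one_plus_square)
  also have "x\<^sup>2 \<le> soft_max (links k) (real 1 + real ((2 * k + 7) * d)) (ratio_sq k) w"
    using soft_max_upper[OF finite_links assms, of "ratio_sq k"] by (simp add: x_def ratio_sq_def)
  finally have "scale_at k * \<bar>x\<bar> \<le> increment_bound k w"
    unfolding increment_bound_def using scale_at_pos[of k] by (intro mult_left_mono) auto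
  then show ?thesis using scale_at_pos[of k] by (simp add: x_def abs_divide)
qed

text \<open>The expected bound is of order (1/2) ^ k * (1 + (k + 1) * d): the geometric scale beats
  the linear growth of the log-cardinality of \<open>links k\<close>.\<close>

lemma AE_summable_increment_bound: "AE w in M. summable (\<lambda>k. increment_bound k w)"
proof (rule AE_summable_of_nn_integral)
  have [measurable]: "soft_max (links k) L (ratio_sq k) \<in> borel_measurable M" for k L
    by (intro soft_max_measurable ratio_sq_measurable)
  show "increment_bound k \<in> borel_measurable M" for k
    unfolding increment_bound_def[abs_def] by measurable
  fix k
  define L where "L = real 1 + real ((2 * k + 7) * d)"
  have L: "0 \<le> L" by (simp add: L_def)
  have "(\<integral>\<^sup>+ w. ennreal (increment_bound k w) \<partial>M)
    = (\<integral>\<^sup>+ w. ennreal (scale_at k) * (1 + ennreal (soft_max (links k) L (ratio_sq k) w)) \<partial>M)"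
    unfolding increment_bound_def L_def[symmetric]
    by (intro nn_integral_cong) (simp add: ennreal_mult less_imp_le[OF scale_at_pos] soft_max_nonneg[OF L])
  also have "\<dots> = ennreal (scale_at k) * (1 + (\<integral>\<^sup>+ w. ennreal (soft_max (links k) L (ratio_sq k) w) \<partial>M))"
    by (simp add: nn_integral_cmult nn_integral_add emeasure_space_1)
  also have "\<dots> \<le> ennreal (scale_at k) * (1 + ennreal (L + 1))"
  proof -
    have "real (card (links k)) * 2 \<le> exp L"
      using two_power_mult_le_exp[OF card_links_real, of k 1] unfolding L_def by simp
    then have "(\<integral>\<^sup>+ w. ennreal (soft_max (links k) L (ratio_sq k) w) \<partial>M) \<le> ennreal (L + 1)"
      by (intro nn_integral_soft_max[OF finite_links ratio_sq_measurable _ _ L, where c = 2]) (simp_all add: nn_integral_exp_ratio_sq)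
    then show ?thesis by (rule mult_left_mono[OF add_left_mono]) simp
  qed
  also have "\<dots> = ennreal ((1/2) ^ k * (9 + (2 * real k + 7) * (3 * real d)))"
  proof -
    have "scale_at k * (1 + (L + 1)) = (1/2) ^ k * (9 + (2 * real k + 7) * (3 * real d))"
      by (simp add: scale_at_def L_def algebra_simps)
    moreover have "1 + ennreal (L + 1) = ennreal (1 + (L + 1))"
      using L by (metis add_nonneg_nonneg ennreal_1 ennreal_plus zero_le_one)
    then have "ennreal (scale_at k) * (1 + ennreal (L + 1)) = ennreal (scale_at k * (1 + (L + 1)))"
      using L less_imp_le[OF scale_at_pos[of k]] by (simp only: ennreal_mult add_nonneg_nonneg zero_le_one)
    ultimately show ?thesis by (simp only:)
  qed
  finally show "(\<integral>\<^sup>+ w. ennreal (increment_bound k w) \<partial>M) \<le> ennreal ((1/2) ^ k * (9 + (2 * real k + 7) * (3 * real d)))" .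
next
  show "(\<Sum>k<K. (1/2) ^ k * (9 + (2 * real k + 7) * (3 * real d))) \<le> 2 * 9 + 18 * (3 * real d)" for K
    by (rule level_weight_sum_le) auto
qed (use increment_bound_nonneg in auto)

text \<open>For a fixed parameter the expected errors decay geometrically, so their sum is finite
  almost surely. The null set here still depends on \<open>\<theta>\<close>.\<close>

lemma AE_proj_converges_at:
  assumes "\<theta> \<in> \<Theta>"
  shows "AE w in M. (\<lambda>k. X (proj k \<theta>) w) \<longlonglongrightarrow> X \<theta> w"
proof -
  have [measurable]: "X \<theta> \<in> borel_measurable M" "X (proj k \<theta>) \<in> borel_measurable M" for k
    using assms proj_\<Theta> X_measurable by auto
  have "AE w in M. summable (\<lambda>k. \<bar>X \<theta> w - X (proj k \<theta>) w\<bar>)"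
  proof (rule AE_summable_of_nn_integral)
    fix k
    \<comment> \<open>This turns the exponential moment into a bound on the mean error; the moment
      is at most 2, hence the factor 6 = 3 * 2 below.\<close>
    have "\<bar>x\<bar> \<le> scale_at k * exp ((x / scale_at k)\<^sup>2)" for x
    proof -
      define y where "y = x / scale_at k"
      have "\<bar>y\<bar> \<le> 1 + y\<^sup>2" by (rule abs_le_one_plus_square)
      also have "\<dots> \<le> exp (y\<^sup>2)" by simp
      finally have "scale_at k * \<bar>y\<bar> \<le> scale_at k * exp (y\<^sup>2)" using scale_at_pos[of k] by simp
      then show ?thesis using scale_at_pos[of k] by (simp add: y_def abs_divide)
    qed
    then have "(\<integral>\<^sup>+ w. ennreal \<bar>X \<theta> w - X (proj k \<theta>) w\<bar> \<partial>M)
        \<le> (\<integral>\<^sup>+ w. ennreal (scale_at k) * ennreal (exp (((X \<theta> w - X (proj k \<theta>) w) / scale_at k)\<^sup>2)) \<partial>M)"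
      using scale_at_pos[of k] by (intro nn_integral_mono) (simp flip: ennreal_mult add: ennreal_leI)
    also have "\<dots> = ennreal (scale_at k) * (\<integral>\<^sup>+ w. ennreal (exp (((X \<theta> w - X (proj k \<theta>) w) / scale_at k)\<^sup>2)) \<partial>M)"
      by (simp add: nn_integral_cmult)
    also have "\<dots> \<le> ennreal (scale_at k) * 2"
      using assms proj_\<Theta>[OF assms, of k] proj_close[OF assms, of k]
      by (intro mult_left_mono increment) (auto simp: scale_at_def intro: le_less_trans)
    also have "\<dots> = ennreal ((1/2) ^ k * 6)"
      by (simp add: scale_at_def ennreal_mult[symmetric] flip: ennreal_numeral)
    finally show "(\<integral>\<^sup>+ w. ennreal \<bar>X \<theta> w - X (proj k \<theta>) w\<bar> \<partial>M) \<le> ennreal ((1/2) ^ k * 6)" .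
  next
    show "(\<Sum>k<K. (1/2) ^ k * (6 :: real)) \<le> 2 * 6 + 18 * 0" for K
      using level_weight_sum_le[of 6 0 K] by simp
  qed auto
  then show ?thesis
  proof eventually_elim
    case (elim w)
    then have "(\<lambda>k. X \<theta> w - X (proj k \<theta>) w) \<longlonglongrightarrow> 0"
      using summable_LIMSEQ_zero tendsto_rabs_zero_iff by blast
    from tendsto_diff[OF tendsto_const[of "X \<theta> w"] this] show ?case by simp
  qed
qed

text \<open>Telescoping over the links from level k on, then a limit. The right-hand side does not
  involve \<open>\<theta>\<close>, so it is uniform over all parameters along whose net points the
  path converges.\<close>

lemma chain_tail_bound:
  assumes "summable (\<lambda>k. increment_bound k w)" "\<theta> \<in> \<Theta>" "(\<lambda>k. X (proj k \<theta>) w) \<longlonglongrightarrow> X \<theta> w"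
  shows "\<bar>X \<theta> w - X (proj k \<theta>) w\<bar> \<le> (\<Sum>j. increment_bound (j + k) w)"
proof (rule tendsto_upperbound)
  show "(\<lambda>m. \<bar>X (proj (m + k) \<theta>) w - X (proj k \<theta>) w\<bar>) \<longlonglongrightarrow> \<bar>X \<theta> w - X (proj k \<theta>) w\<bar>"
    by (intro tendsto_intros LIMSEQ_ignore_initial_segment assms(3))
  have "\<bar>X (proj (m + k) \<theta>) w - X (proj k \<theta>) w\<bar> \<le> (\<Sum>j<m. increment_bound (j + k) w)" for m
  proof (induction m)
    case (Suc m)
    have "\<bar>X (proj (m + k) \<theta>) w - X (proj (Suc m + k) \<theta>) w\<bar> \<le> increment_bound (m + k) w"
      using increment_bound_upper[OF proj_link[OF assms(2,2), of "m + k"]] zero by simp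
    then show ?case using Suc by simp
  qed simp
  also have "(\<Sum>j<m. increment_bound (j + k) w) \<le> (\<Sum>j. increment_bound (j + k) w)" for m
    using assms(1) increment_bound_nonneg by (intro sum_le_suminf summable_ignore_initial_segment) auto
  finally show "\<forall>\<^sub>F m in sequentially. \<bar>X (proj (m + k) \<theta>) w - X (proj k \<theta>) w\<bar> \<le> (\<Sum>j. increment_bound (j + k) w)"
    by simp
qed simp

text \<open>
  For several samples at once, separability does not suffice directly: the sequences approaching \<open>\<theta>\<close>
  may differ from one sample point to the next. The net points \<open>proj k \<theta>\<close> serve for all of them.
\<close>

lemma AE_proj_converges: "AE w in M. \<forall>\<theta>\<in>\<Theta>. (\<lambda>k. X (proj k \<theta>) w) \<longlonglongrightarrow> X \<theta> w"
proof -
  obtain \<Theta>\<^sub>0 where \<Theta>\<^sub>0: "\<Theta>\<^sub>0 \<subseteq> \<Theta>" "countable \<Theta>\<^sub>0"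
    "AE w in M. \<forall>\<theta>\<in>\<Theta>. \<exists>s. (\<forall>k. s k \<in> \<Theta>\<^sub>0) \<and> s \<longlonglongrightarrow> \<theta> \<and> (\<lambda>k::nat. X (s k) w) \<longlonglongrightarrow> X \<theta> w"
    using separable by (auto simp: separable_process_def)
  \<comment> \<open>Countability of \<open>\<Theta>\<^sub>0\<close> allows the null sets of
    \<open>AE_proj_converges_at\<close> to be united.\<close>
  have "AE w in M. \<forall>\<theta>\<in>\<Theta>\<^sub>0. (\<lambda>k. X (proj k \<theta>) w) \<longlonglongrightarrow> X \<theta> w"
    using \<Theta>\<^sub>0(1,2) by (subst AE_ball_countable) (auto intro: AE_proj_converges_at)
  with AE_summable_increment_bound \<Theta>\<^sub>0(3) show ?thesis
  proof eventually_elim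
    case (elim w)
    define r where "r k = (\<Sum>j. increment_bound (j + k) w)" for k
    have "r \<longlonglongrightarrow> 0" unfolding r_def[abs_def] by (rule suminf_exist_split2[OF elim(1)])
    show ?case
    proof
      fix \<theta> assume \<theta>: "\<theta> \<in> \<Theta>"
      then obtain s where s: "\<And>k. s k \<in> \<Theta>\<^sub>0" "s \<longlonglongrightarrow> \<theta>" "(\<lambda>k. X (s k) w) \<longlonglongrightarrow> X \<theta> w"
        using elim(2) by blast
      \<comment> \<open>From \<open>s m\<close> the path is followed to its own level-k net point,
        with error at most \<open>r k\<close>, and from there along a link to the level-(k + 1) net
        point of \<open>\<theta>\<close>. How large m must be depends on k, but the bound does not
        involve m.\<close>
      have close: "\<bar>X \<theta> w - X (proj (Suc k) \<theta>) w\<bar> \<le> r k + increment_bound k w" for k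
      proof (rule tendsto_upperbound)
        show "(\<lambda>m. \<bar>X (s m) w - X (proj (Suc k) \<theta>) w\<bar>) \<longlonglongrightarrow> \<bar>X \<theta> w - X (proj (Suc k) \<theta>) w\<bar>"
          by (intro tendsto_intros s)
        have "\<forall>\<^sub>F m in sequentially. p (s m - \<theta>) \<le> (1/2) ^ Suc k"
          using s(1) \<Theta>\<^sub>0(1) \<theta> \<Theta>_Rspace by (intro tendsto_norm_diff s(2)) auto
        then show "\<forall>\<^sub>F m in sequentially. \<bar>X (s m) w - X (proj (Suc k) \<theta>) w\<bar> \<le> r k + increment_bound k w"
        proof eventually_elim
          case (elim m)
          have "s m \<in> \<Theta>" using s(1) \<Theta>\<^sub>0(1) by auto
          then have "\<bar>X (proj k (s m)) w - X (proj (Suc k) \<theta>) w\<bar> \<le> increment_bound k w"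
            by (intro increment_bound_upper proj_link \<theta> elim)
          moreover have "\<bar>X (s m) w - X (proj k (s m)) w\<bar> \<le> r k"
            unfolding r_def using \<open>s m \<in> \<Theta>\<close> s(1)
              \<open>summable (\<lambda>k. increment_bound k w)\<close> \<open>\<forall>\<theta>\<in>\<Theta>\<^sub>0. (\<lambda>k. X (proj k \<theta>) w) \<longlonglongrightarrow> X \<theta> w\<close>
            by (intro chain_tail_bound) auto
          ultimately show ?case by linarith
        qed
      qed simp
      have "(\<lambda>k. r k + increment_bound k w) \<longlonglongrightarrow> 0"
        using tendsto_add[OF \<open>r \<longlonglongrightarrow> 0\<close> summable_LIMSEQ_zero[OF elim(1)]] by simp
      moreover have "\<forall>\<^sub>F k in sequentially. norm (X \<theta> w - X (proj (Suc k) \<theta>) w) \<le> r k + increment_bound k w"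
        by (simp add: close)
      ultimately have "(\<lambda>k. X \<theta> w - X (proj (Suc k) \<theta>) w) \<longlonglongrightarrow> 0"
        by (rule Lim_null_comparison[rotated])
      from tendsto_diff[OF tendsto_const[of "X \<theta> w"] this]
      have "(\<lambda>k. X (proj (Suc k) \<theta>) w) \<longlonglongrightarrow> X \<theta> w" by simp
      then show "(\<lambda>k. X (proj k \<theta>) w) \<longlonglongrightarrow> X \<theta> w" by (rule LIMSEQ_imp_Suc)
    qed
  qed
qed

section \<open>Sums of squares over a sample\<close>

lemma nn_integral_exp_sample_sum:
  assumes g: "g \<in> borel_measurable M" and "(\<integral>\<^sup>+ w. ennreal (exp (g w)) \<partial>M) \<le> 2" and "finite I"
  shows "(\<integral>\<^sup>+ S. ennreal (exp (\<Sum>i\<in>I. g (S i))) \<partial>(\<Pi>\<^sub>M i\<in>I. M)) \<le> ennreal (2 ^ card I)"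
proof -
  interpret product_sigma_finite "\<lambda>_. M" by standard
  note g[measurable]
  have "(\<integral>\<^sup>+ S. ennreal (exp (\<Sum>i\<in>I. g (S i))) \<partial>(\<Pi>\<^sub>M i\<in>I. M))
      = (\<integral>\<^sup>+ S. (\<Prod>i\<in>I. ennreal (exp (g (S i)))) \<partial>(\<Pi>\<^sub>M i\<in>I. M))"
    using assms(3) by (simp add: exp_sum prod_ennreal)
  \<comment> \<open>Independence factorises the moment; each sample costs a factor 2, which adds at
    most 1 to the level of the soft maximum.\<close>
  also have "\<dots> = (\<Prod>i\<in>I. \<integral>\<^sup>+ w. ennreal (exp (g w)) \<partial>M)"
    by (rule product_nn_integral_prod[OF assms(3)]) measurable
  also have "\<dots> \<le> (\<Prod>i\<in>I. 2)" by (intro prod_mono_ennreal assms)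
  also have "\<dots> = ennreal (2 ^ card I)" by (simp flip: ennreal_power)
  finally show ?thesis .
qed

text \<open>The level n + (2 * k + 7) * d bounds the logarithm of \<open>card (links k)\<close>
  times the moment bound 2 ^ n.\<close>

definition sample_level :: "nat \<Rightarrow> nat \<Rightarrow> (nat \<Rightarrow> 'a) \<Rightarrow> real" where
  "sample_level n k = soft_max (links k) (real n + real ((2 * k + 7) * d)) (\<lambda>q S. \<Sum>i=1..n. ratio_sq k q (S i))"

definition sample_base :: "nat \<Rightarrow> (nat \<Rightarrow> 'a) \<Rightarrow> real" where
  "sample_base n = soft_max (N 0) (real n + real (3 * d)) (\<lambda>s S. \<Sum>i=1..n. (X s (S i) / 3)\<^sup>2)"

text \<open>Values in \<open>ennreal\<close> let the series be formed without asking for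
  summability. The factor 27 is 3 from \<open>weighted_chain_square\<close> times 3^2 from the
  scales.\<close>

definition sample_bound :: "nat \<Rightarrow> (nat \<Rightarrow> 'a) \<Rightarrow> ennreal" where
  "sample_bound n S = 27 * (ennreal (sample_base n S) + (\<Sum>k. ennreal ((1/2) ^ k) * ennreal (sample_level n k S)))"

lemma sample_nonneg: "0 \<le> sample_level n k S" "0 \<le> sample_base n S"
  by (simp_all add: sample_level_def sample_base_def soft_max_nonneg)

lemma sample_sum_measurable:
  fixes g :: "'a \<Rightarrow> real"
  assumes "g \<in> borel_measurable M"
  shows "(\<lambda>S. \<Sum>i=1..n. g (S i)) \<in> borel_measurable (\<Pi>\<^sub>M i\<in>{1..n}. M)"
proof (rule borel_measurable_sum)
  fix i assume "i \<in> {1..n}"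
  then have "(\<lambda>S. S i) \<in> (\<Pi>\<^sub>M i\<in>{1..n}. M) \<rightarrow>\<^sub>M M" by (rule measurable_component_singleton)
  then show "(\<lambda>S. g (S i)) \<in> borel_measurable (\<Pi>\<^sub>M i\<in>{1..n}. M)" by (rule measurable_compose) (rule assms)
qed

lemma base_sq_measurable: "s \<in> N 0 \<Longrightarrow> (\<lambda>w. (X s w / 3)\<^sup>2) \<in> borel_measurable M"
  using X_measurable[of s] N_sub[of 0]
  by (intro borel_measurable_power borel_measurable_divide borel_measurable_const) auto

lemma sample_level_measurable [measurable]: "sample_level n k \<in> borel_measurable (\<Pi>\<^sub>M i\<in>{1..n}. M)"
  unfolding sample_level_def by (intro soft_max_measurable sample_sum_measurable ratio_sq_measurable)

lemma sample_base_measurable [measurable]: "sample_base n \<in> borel_measurable (\<Pi>\<^sub>M i\<in>{1..n}. M)"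
  unfolding sample_base_def by (intro soft_max_measurable sample_sum_measurable base_sq_measurable)

lemma sample_bound_measurable [measurable]: "sample_bound n \<in> borel_measurable (\<Pi>\<^sub>M i\<in>{1..n}. M)"
  unfolding sample_bound_def[abs_def] by measurable

lemma nn_integral_sample_level:
  "(\<integral>\<^sup>+ S. ennreal (sample_level n k S) \<partial>(\<Pi>\<^sub>M i\<in>{1..n}. M)) \<le> ennreal (real n + real ((2 * k + 7) * d) + 1)"
proof -
  interpret P: prob_space "\<Pi>\<^sub>M i\<in>{1..n}. M" by (intro prob_space_PiM prob_space_axioms)
  have "real (card (links k)) * 2 ^ n \<le> exp (real n + real ((2 * k + 7) * d))"
    by (rule two_power_mult_le_exp[OF card_links_real])
  moreover have "(\<integral>\<^sup>+ S. ennreal (exp (\<Sum>i=1..n. ratio_sq k q (S i))) \<partial>(\<Pi>\<^sub>M i\<in>{1..n}. M)) \<le> ennreal (2 ^ n)"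
    if "q \<in> links k" for q
    using nn_integral_exp_sample_sum[OF ratio_sq_measurable[OF that] nn_integral_exp_ratio_sq[OF that], of "{1..n}"] by simp
  ultimately show ?thesis
    unfolding sample_level_def
    by (intro P.nn_integral_soft_max[where c = "2 ^ n"] finite_links sample_sum_measurable ratio_sq_measurable) auto
qed

lemma nn_integral_sample_base:
  "(\<integral>\<^sup>+ S. ennreal (sample_base n S) \<partial>(\<Pi>\<^sub>M i\<in>{1..n}. M)) \<le> ennreal (real n + real (3 * d) + 1)"
proof -
  interpret P: prob_space "\<Pi>\<^sub>M i\<in>{1..n}. M" by (intro prob_space_PiM prob_space_axioms)
  have "real (card (N 0)) \<le> 2 ^ (3 * d)"
    using card_N[of 0] by (metis add_0 of_nat_le_iff of_nat_numeral of_nat_power)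
  then have "real (card (N 0)) * 2 ^ n \<le> exp (real n + real (3 * d))" by (rule two_power_mult_le_exp)
  moreover have "(\<integral>\<^sup>+ S. ennreal (exp (\<Sum>i=1..n. (X s (S i) / 3)\<^sup>2)) \<partial>(\<Pi>\<^sub>M i\<in>{1..n}. M)) \<le> ennreal (2 ^ n)"
    if "s \<in> N 0" for s
    using nn_integral_exp_sample_sum[OF base_sq_measurable[OF that] single, of "{1..n}"] that N_sub by auto
  ultimately show ?thesis
    unfolding sample_base_def
    by (intro P.nn_integral_soft_max[where c = "2 ^ n"] finite_N sample_sum_measurable base_sq_measurable) auto
qed

lemma nn_integral_sample_bound:
  assumes "1 \<le> n"
  shows "(\<integral>\<^sup>+ S. sample_bound n S \<partial>(\<Pi>\<^sub>M i\<in>{1..n}. M)) \<le> ennreal (600 * (real n + real d))"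
proof -
  define a where "a = real n + 1"
  define b where "b = real d"
  have ab: "0 \<le> a" "0 \<le> b" by (auto simp: a_def b_def)
  let ?P = "\<Pi>\<^sub>M i\<in>{1..n}. M"
  have "(\<integral>\<^sup>+ S. sample_bound n S \<partial>?P)
      = 27 * (\<integral>\<^sup>+ S. ennreal (sample_base n S) + (\<Sum>k. ennreal ((1/2) ^ k) * ennreal (sample_level n k S)) \<partial>?P)"
    unfolding sample_bound_def by (intro nn_integral_cmult) measurable
  moreover have "\<dots> = 27 * ((\<integral>\<^sup>+ S. ennreal (sample_base n S) \<partial>?P)
      + (\<integral>\<^sup>+ S. (\<Sum>k. ennreal ((1/2) ^ k) * ennreal (sample_level n k S)) \<partial>?P))"
    by (intro arg_cong[where f = "(*) 27"] nn_integral_add) measurable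
  moreover have "(\<integral>\<^sup>+ S. (\<Sum>k. ennreal ((1/2) ^ k) * ennreal (sample_level n k S)) \<partial>?P)
      = (\<Sum>k. \<integral>\<^sup>+ S. ennreal ((1/2) ^ k) * ennreal (sample_level n k S) \<partial>?P)"
    by (intro nn_integral_suminf) measurable
  moreover have "\<dots> = (\<Sum>k. ennreal ((1/2) ^ k) * (\<integral>\<^sup>+ S. ennreal (sample_level n k S) \<partial>?P))"
    by (intro suminf_cong nn_integral_cmult) measurable
  ultimately have "(\<integral>\<^sup>+ S. sample_bound n S \<partial>?P) = 27 * ((\<integral>\<^sup>+ S. ennreal (sample_base n S) \<partial>?P)
      + (\<Sum>k. ennreal ((1/2) ^ k) * (\<integral>\<^sup>+ S. ennreal (sample_level n k S) \<partial>?P)))"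
    by (simp only:)
  also have "\<dots> \<le> 27 * (ennreal (a + 3 * b) + (\<Sum>k. ennreal ((1/2) ^ k * (a + (2 * real k + 7) * b))))"
  proof (intro mult_left_mono add_mono suminf_le summableI)
    show "(\<integral>\<^sup>+ S. ennreal (sample_base n S) \<partial>(\<Pi>\<^sub>M i\<in>{1..n}. M)) \<le> ennreal (a + 3 * b)"
      using nn_integral_sample_base[of n] by (simp add: a_def b_def algebra_simps)
    fix k
    have "(\<integral>\<^sup>+ S. ennreal (sample_level n k S) \<partial>(\<Pi>\<^sub>M i\<in>{1..n}. M)) \<le> ennreal (a + (2 * real k + 7) * b)"
      using nn_integral_sample_level[of n k] by (simp add: a_def b_def algebra_simps)
    then have "ennreal ((1/2) ^ k) * (\<integral>\<^sup>+ S. ennreal (sample_level n k S) \<partial>(\<Pi>\<^sub>M i\<in>{1..n}. M))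
        \<le> ennreal ((1/2) ^ k) * ennreal (a + (2 * real k + 7) * b)" by (rule mult_left_mono) simp
    also have "\<dots> = ennreal ((1/2) ^ k * (a + (2 * real k + 7) * b))"
      using ab by (intro ennreal_mult[symmetric]) auto
    finally show "ennreal ((1/2) ^ k) * (\<integral>\<^sup>+ S. ennreal (sample_level n k S) \<partial>(\<Pi>\<^sub>M i\<in>{1..n}. M))
        \<le> ennreal ((1/2) ^ k * (a + (2 * real k + 7) * b))" .
  qed auto
  also have "\<dots> \<le> 27 * (ennreal (a + 3 * b) + ennreal (2 * a + 18 * b))"
  proof (intro mult_left_mono add_left_mono)
    have "(\<Sum>k<K. ennreal ((1/2) ^ k * (a + (2 * real k + 7) * b))) \<le> ennreal (2 * a + 18 * b)" for K
      using ennreal_leI[OF level_weight_sum_le[OF ab, of K]] sum_ennreal[of "{..<K}" "\<lambda>k. (1/2) ^ k * (a + (2 * real k + 7) * b)"] ab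
      by (metis (no_types, lifting) add_nonneg_nonneg mult_nonneg_nonneg of_nat_0_le_iff zero_le_numeral zero_le_power zero_le_divide_1_iff)
    then show "(\<Sum>k. ennreal ((1/2) ^ k * (a + (2 * real k + 7) * b))) \<le> ennreal (2 * a + 18 * b)"
      unfolding suminf_eq_SUP by (intro SUP_least)
  qed simp
  also have "\<dots> = ennreal 27 * ennreal ((a + 3 * b) + (2 * a + 18 * b))"
    using ab by (subst (3) ennreal_plus) auto
  also have "\<dots> = ennreal (27 * ((a + 3 * b) + (2 * a + 18 * b)))"
    using ab by (intro ennreal_mult[symmetric]) auto
  \<comment> \<open>The left side is 81 * (n + 1) + 567 * d, and n + 1 <= 2 * n.\<close>
  also have "\<dots> \<le> ennreal (600 * (real n + real d))"
    using assms by (intro ennreal_leI) (simp add: a_def b_def)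
  finally show ?thesis .
qed

lemma chain_square_bound:
  assumes "\<theta> \<in> \<Theta>"
  shows "(\<Sum>i=1..n. (X (proj K \<theta>) (S i))\<^sup>2)
    \<le> 27 * (sample_base n S + (\<Sum>k<K. (1/2) ^ k * sample_level n k S))"
proof -
  define v where "v k i = X (proj (Suc k) \<theta>) (S i) - X (proj k \<theta>) (S i)" for k i
  have telescope: "X (proj 0 \<theta>) w + (\<Sum>k<K. X (proj (Suc k) \<theta>) w - X (proj k \<theta>) w) = X (proj K \<theta>) w" for w
    using sum_lessThan_telescope[of "\<lambda>k. X (proj k \<theta>) w" K for w] by simp
  have "(X (proj K \<theta>) (S i))\<^sup>2 \<le> 3 * ((X (proj 0 \<theta>) (S i))\<^sup>2 + (\<Sum>k<K. 2 ^ k * (v k i)\<^sup>2))" for i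
    using weighted_chain_square[of "X (proj 0 \<theta>) (S i)" "\<lambda>k. v k i" K] unfolding v_def telescope .
  then have "(\<Sum>i=1..n. (X (proj K \<theta>) (S i))\<^sup>2)
      \<le> (\<Sum>i=1..n. 3 * ((X (proj 0 \<theta>) (S i))\<^sup>2 + (\<Sum>k<K. 2 ^ k * (v k i)\<^sup>2)))"
    by (rule sum_mono)
  also have "\<dots> = 3 * ((\<Sum>i=1..n. (X (proj 0 \<theta>) (S i))\<^sup>2) + (\<Sum>i=1..n. \<Sum>k<K. 2 ^ k * (v k i)\<^sup>2))"
    by (simp only: sum_distrib_left[symmetric] sum.distrib)
  also have "(\<Sum>i=1..n. \<Sum>k<K. 2 ^ k * (v k i)\<^sup>2) = (\<Sum>k<K. 2 ^ k * (\<Sum>i=1..n. (v k i)\<^sup>2))"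
    by (subst sum.swap) (simp only: sum_distrib_left)
  also have "3 * ((\<Sum>i=1..n. (X (proj 0 \<theta>) (S i))\<^sup>2) + (\<Sum>k<K. 2 ^ k * (\<Sum>i=1..n. (v k i)\<^sup>2)))
      \<le> 3 * (9 * sample_base n S + (\<Sum>k<K. 9 * ((1/2) ^ k * sample_level n k S)))"
  proof (intro mult_left_mono add_mono sum_mono)
    have "(\<Sum>i=1..n. (X (proj 0 \<theta>) (S i) / 3)\<^sup>2) \<le> sample_base n S"
      unfolding sample_base_def by (rule soft_max_upper[OF finite_N proj_N[OF assms]])
    then show "(\<Sum>i=1..n. (X (proj 0 \<theta>) (S i))\<^sup>2) \<le> 9 * sample_base n S"
      by (simp add: power_divide sum_divide_distrib[symmetric])
    fix k
    have "(proj k \<theta>, proj (Suc k) \<theta>) \<in> links k" by (intro proj_link assms) (simp add: zero)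
    from soft_max_upper[OF finite_links this, of "\<lambda>q S. \<Sum>i=1..n. ratio_sq k q (S i)"]
    have "(\<Sum>i=1..n. (v k i / scale_at k)\<^sup>2) \<le> sample_level n k S"
      unfolding sample_level_def by (simp add: ratio_sq_def v_def power_divide power2_commute)
    then have "(\<Sum>i=1..n. (v k i)\<^sup>2) \<le> (scale_at k)\<^sup>2 * sample_level n k S"
      using scale_at_pos[of k] by (simp add: power_divide sum_divide_distrib[symmetric] field_simps)
    then have "2 ^ k * (\<Sum>i=1..n. (v k i)\<^sup>2) \<le> 2 ^ k * ((scale_at k)\<^sup>2 * sample_level n k S)" by simp
    also have "2 ^ k * (scale_at k)\<^sup>2 = 9 * (1/2) ^ k"
      by (simp add: scale_at_def power2_eq_square power_divide)
    then have "2 ^ k * ((scale_at k)\<^sup>2 * sample_level n k S) = 9 * ((1/2) ^ k * sample_level n k S)"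
      by (metis mult.assoc)
    finally show "2 ^ k * (\<Sum>i=1..n. (v k i)\<^sup>2) \<le> 9 * ((1/2) ^ k * sample_level n k S)" .
  qed simp
  also have "\<dots> = 27 * (sample_base n S + (\<Sum>k<K. (1/2) ^ k * sample_level n k S))"
    by (simp only: sum_distrib_left[symmetric] distrib_left)
  finally show ?thesis .
qed

text \<open>\<open>chain_square_bound\<close> holds at every finite depth K, and the sample is
  finite, so the sum of squares passes to the limit.\<close>

lemma square_sum_le_sample_bound:
  assumes "\<theta> \<in> \<Theta>" "\<And>i. i \<in> {1..n} \<Longrightarrow> (\<lambda>k. X (proj k \<theta>) (S i)) \<longlonglongrightarrow> X \<theta> (S i)"
  shows "ennreal (\<Sum>i=1..n. (X \<theta> (S i))\<^sup>2) \<le> sample_bound n S"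
proof (rule LIMSEQ_le_const2)
  show "(\<lambda>K. ennreal (\<Sum>i=1..n. (X (proj K \<theta>) (S i))\<^sup>2)) \<longlonglongrightarrow> ennreal (\<Sum>i=1..n. (X \<theta> (S i))\<^sup>2)"
    by (intro tendsto_ennrealI tendsto_sum tendsto_power assms(2))
  have "ennreal (\<Sum>i=1..n. (X (proj K \<theta>) (S i))\<^sup>2) \<le> sample_bound n S" for K
  proof -
    have "ennreal (\<Sum>i=1..n. (X (proj K \<theta>) (S i))\<^sup>2)
        \<le> ennreal (27 * (sample_base n S + (\<Sum>k<K. (1/2) ^ k * sample_level n k S)))"
      by (intro ennreal_leI chain_square_bound assms)
    also have "\<dots> = 27 * (ennreal (sample_base n S) + (\<Sum>k<K. ennreal ((1/2) ^ k) * ennreal (sample_level n k S)))"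
      by (simp add: ennreal_mult sum_nonneg sample_nonneg sum_ennreal[symmetric])
    also have "\<dots> \<le> sample_bound n S"
      unfolding sample_bound_def by (intro mult_left_mono add_left_mono sum_le_suminf summableI) auto
    finally show ?thesis .
  qed
  then show "\<exists>N. \<forall>K\<ge>N. ennreal (\<Sum>i=1..n. (X (proj K \<theta>) (S i))\<^sup>2) \<le> sample_bound n S" by blast
qed

text \<open>The quantifier over \<open>\<theta>\<close> stands inside the almost-everywhere
  statement: the algorithm chooses its output after seeing S, so null sets depending on
  \<open>\<theta>\<close> would not do.\<close>

lemma AE_square_sum_le_sample_bound:
  "AE S in (\<Pi>\<^sub>M i\<in>{1..n}. M). \<forall>\<theta>\<in>\<Theta>. ennreal (\<Sum>i=1..n. (X \<theta> (S i))\<^sup>2) \<le> sample_bound n S"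
proof -
  have "AE S in (\<Pi>\<^sub>M i\<in>{1..n}. M). \<forall>i\<in>{1..n}. \<forall>\<theta>\<in>\<Theta>. (\<lambda>k. X (proj k \<theta>) (S i)) \<longlonglongrightarrow> X \<theta> (S i)"
  proof (subst AE_ball_countable)
    have "AE S in (\<Pi>\<^sub>M i\<in>{1..n}. M). \<forall>\<theta>\<in>\<Theta>. (\<lambda>k. X (proj k \<theta>) (S i)) \<longlonglongrightarrow> X \<theta> (S i)" if "i \<in> {1..n}" for i
      using AE_PiM_component[of "{1..n}" "\<lambda>_. M" i "\<lambda>w. \<forall>\<theta>\<in>\<Theta>. (\<lambda>k. X (proj k \<theta>) w) \<longlonglongrightarrow> X \<theta> w"]
        that AE_proj_converges prob_space_axioms by blast
    then show "\<forall>i\<in>{1..n}. AE S in (\<Pi>\<^sub>M i\<in>{1..n}. M). \<forall>\<theta>\<in>\<Theta>. (\<lambda>k. X (proj k \<theta>) (S i)) \<longlonglongrightarrow> X \<theta> (S i)"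
      by blast
  qed simp
  then show ?thesis by (rule AE_mp) (blast intro: AE_I2 square_sum_le_sample_bound)
qed

end

section \<open>The law of a run\<close>

locale algorithm_run =
  fixes \<Theta> :: "(nat \<Rightarrow> real) set" and Z :: "'z measure" and n :: nat and A :: "'z alg" and D :: "'z measure"
  assumes algorithm: "algorithm \<Theta> Z n A" and D: "D \<in> space (prob_algebra Z)"
begin

sublocale D: prob_space D
  using D by (simp add: space_prob_algebra)

sublocale DD: product_sigma_finite "\<lambda>_ :: nat. D" by standard

lemma sets_D [measurable_cong]: "sets D = sets Z"
  using D by (simp add: space_prob_algebra)

lemma space_D: "space D = space Z"
  using sets_D by (rule sets_eq_imp_space_eq)

lemma A_measurable [measurable]: "A \<in> (\<Pi>\<^sub>M i\<in>{1..n}. D) \<rightarrow>\<^sub>M prob_algebra (param_space \<Theta>)"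
proof -
  have "sets (\<Pi>\<^sub>M i\<in>{1..n}. D) = sets (\<Pi>\<^sub>M i\<in>{1..n}. Z)" by (intro sets_PiM_cong) (auto simp: sets_D)
  then show ?thesis using algorithm by (simp add: algorithm_def cong: measurable_cong_sets)
qed

lemma A_restrict_measurable:
  "{1..n} \<subseteq> I \<Longrightarrow> (\<lambda>S. A (restrict S {1..n})) \<in> (\<Pi>\<^sub>M i\<in>I. D) \<rightarrow>\<^sub>M prob_algebra (param_space \<Theta>)"
  by (rule measurable_compose[OF measurable_restrict_subset A_measurable])

lemma output_law:
  assumes "S \<in> space (\<Pi>\<^sub>M i\<in>{1..n}. D)"
  shows "prob_space (A S)" "sets (A S) = sets (param_space \<Theta>)" "space (A S) = \<Theta>"
proof -
  show *: "prob_space (A S)" "sets (A S) = sets (param_space \<Theta>)"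
    using measurable_space[OF A_measurable assms] by (auto simp: space_prob_algebra)
  show "space (A S) = \<Theta>" using sets_eq_imp_space_eq[OF *(2)] by (simp add: space_restrict_space)
qed

lemma output_kernel:
  assumes "{1..n} \<subseteq> I"
  shows "(\<lambda>S. A (restrict S {1..n}) \<bind> (\<lambda>\<theta>. return ((\<Pi>\<^sub>M i\<in>I. D) \<Otimes>\<^sub>M param_space \<Theta>) (S, \<theta>)))
    \<in> (\<Pi>\<^sub>M i\<in>I. D) \<rightarrow>\<^sub>M prob_algebra ((\<Pi>\<^sub>M i\<in>I. D) \<Otimes>\<^sub>M param_space \<Theta>)"
  by (rule measurable_bind_prob_space2[OF A_restrict_measurable[OF assms]]) simp

lemma prod_in_prob_algebra: "(\<Pi>\<^sub>M i\<in>I. D) \<in> space (prob_algebra (\<Pi>\<^sub>M i\<in>I. D))"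
  by (simp add: space_prob_algebra prob_space_PiM D.prob_space_axioms)

lemma prob_space_run_law: "{1..n} \<subseteq> I \<Longrightarrow> prob_space (run_law \<Theta> I n D A)"
  unfolding run_law_def by (rule prob_space_bind'[OF prod_in_prob_algebra output_kernel])

lemma sets_run_law:
  "{1..n} \<subseteq> I \<Longrightarrow> sets (run_law \<Theta> I n D A) = sets ((\<Pi>\<^sub>M i\<in>I. D) \<Otimes>\<^sub>M param_space \<Theta>)"
  unfolding run_law_def by (rule sets_bind'[OF prod_in_prob_algebra output_kernel])

lemma space_run_law:
  "{1..n} \<subseteq> I \<Longrightarrow> space (run_law \<Theta> I n D A) = space (\<Pi>\<^sub>M i\<in>I. D) \<times> \<Theta>"
  using sets_eq_imp_space_eq[OF sets_run_law] by (simp add: space_pair_measure space_restrict_space)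

lemma measurable_run_law:
  "{1..n} \<subseteq> I \<Longrightarrow> measurable (run_law \<Theta> I n D A) N = measurable ((\<Pi>\<^sub>M i\<in>I. D) \<Otimes>\<^sub>M param_space \<Theta>) N"
  by (rule measurable_cong_sets[OF sets_run_law refl])

lemma restrict_in_space: "{1..n} \<subseteq> I \<Longrightarrow> S \<in> space (\<Pi>\<^sub>M i\<in>I. D) \<Longrightarrow> restrict S {1..n} \<in> space (\<Pi>\<^sub>M i\<in>{1..n}. D)"
  using measurable_space[OF measurable_restrict_subset] by blast

lemma nn_integral_run_law:
  assumes I: "{1..n} \<subseteq> I" and g: "g \<in> borel_measurable ((\<Pi>\<^sub>M i\<in>I. D) \<Otimes>\<^sub>M param_space \<Theta>)"
  shows "(\<integral>\<^sup>+ w. g w \<partial>run_law \<Theta> I n D A)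
    = (\<integral>\<^sup>+ S. (\<integral>\<^sup>+ \<theta>. g (S, \<theta>) \<partial>A (restrict S {1..n})) \<partial>(\<Pi>\<^sub>M i\<in>I. D))"
proof -
  let ?R = "(\<Pi>\<^sub>M i\<in>I. D) \<Otimes>\<^sub>M param_space \<Theta>"
  have "(\<integral>\<^sup>+ w. g w \<partial>run_law \<Theta> I n D A)
      = (\<integral>\<^sup>+ S. (\<integral>\<^sup>+ w. g w \<partial>(A (restrict S {1..n}) \<bind> (\<lambda>\<theta>. return ?R (S, \<theta>)))) \<partial>(\<Pi>\<^sub>M i\<in>I. D))"
    unfolding run_law_def by (rule nn_integral_bind[OF g measurable_prob_algebraD[OF output_kernel[OF I]]])
  also have "\<dots> = (\<integral>\<^sup>+ S. (\<integral>\<^sup>+ \<theta>. g (S, \<theta>) \<partial>A (restrict S {1..n})) \<partial>(\<Pi>\<^sub>M i\<in>I. D))"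
  proof (rule nn_integral_cong)
    fix S assume S: "S \<in> space (\<Pi>\<^sub>M i\<in>I. D)"
    note A = output_law[OF restrict_in_space[OF I S]]
    have "(\<lambda>\<theta>. (S, \<theta>)) \<in> A (restrict S {1..n}) \<rightarrow>\<^sub>M ?R"
      using S by (subst measurable_cong_sets[OF A(2) refl]) simp
    then have "(\<lambda>\<theta>. return ?R (S, \<theta>)) \<in> A (restrict S {1..n}) \<rightarrow>\<^sub>M subprob_algebra ?R"
      by (rule measurable_compose) (rule return_measurable)
    then have "(\<integral>\<^sup>+ w. g w \<partial>(A (restrict S {1..n}) \<bind> (\<lambda>\<theta>. return ?R (S, \<theta>))))
        = (\<integral>\<^sup>+ \<theta>. (\<integral>\<^sup>+ w. g w \<partial>return ?R (S, \<theta>)) \<partial>A (restrict S {1..n}))"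
      by (rule nn_integral_bind[OF g])
    also have "\<dots> = (\<integral>\<^sup>+ \<theta>. g (S, \<theta>) \<partial>A (restrict S {1..n}))"
      using S A(3) by (intro nn_integral_cong nn_integral_return g) (simp add: space_pair_measure space_restrict_space)
    finally show "(\<integral>\<^sup>+ w. g w \<partial>(A (restrict S {1..n}) \<bind> (\<lambda>\<theta>. return ?R (S, \<theta>))))
        = (\<integral>\<^sup>+ \<theta>. g (S, \<theta>) \<partial>A (restrict S {1..n}))" .
  qed
  finally show ?thesis .
qed

lemma inner_integral_measurable:
  assumes g: "g \<in> borel_measurable ((\<Pi>\<^sub>M i\<in>{1..n}. D) \<Otimes>\<^sub>M param_space \<Theta>)"
  shows "(\<lambda>S. \<integral>\<^sup>+ \<theta>. g (S, \<theta>) \<partial>A S) \<in> borel_measurable (\<Pi>\<^sub>M i\<in>{1..n}. D)"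
  by (rule nn_integral_measurable_subprob_algebra2[OF _ measurable_prob_algebraD[OF A_measurable]])
    (use g in simp)

lemma forget_measurable:
  "{1..n} \<subseteq> I \<Longrightarrow> (\<lambda>(S, \<theta>). (restrict S {1..n}, \<theta>))
    \<in> (\<Pi>\<^sub>M i\<in>I. D) \<Otimes>\<^sub>M param_space \<Theta> \<rightarrow>\<^sub>M (\<Pi>\<^sub>M i\<in>{1..n}. D) \<Otimes>\<^sub>M param_space \<Theta>"
  unfolding split_beta
  by (intro measurable_Pair measurable_compose[OF measurable_fst measurable_restrict_subset] measurable_snd)

text \<open>Traceability refers to runs with the fresh sample of index 0, the trace value to runs
  without it. Since the algorithm reads only \<open>{1..n}\<close>, dropping the other coordinates
  carries one law to the other.\<close>

lemma run_law_forget: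
  assumes I: "{1..n} \<subseteq> I" "finite I"
  shows "distr (run_law \<Theta> I n D A) ((\<Pi>\<^sub>M i\<in>{1..n}. D) \<Otimes>\<^sub>M param_space \<Theta>) (\<lambda>(S, \<theta>). (restrict S {1..n}, \<theta>))
    = run_law \<Theta> {1..n} n D A"
proof (rule measure_eqI)
  let ?P = "\<Pi>\<^sub>M i\<in>{1..n}. D" and ?h = "\<lambda>(S, \<theta>). (restrict S {1..n} :: nat \<Rightarrow> 'z, \<theta> :: nat \<Rightarrow> real)"
  note forget = forget_measurable[OF I(1)]
  fix X assume "X \<in> sets (distr (run_law \<Theta> I n D A) (?P \<Otimes>\<^sub>M param_space \<Theta>) ?h)"
  then have X: "X \<in> sets (?P \<Otimes>\<^sub>M param_space \<Theta>)" by simp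
  then have X': "indicator X \<in> borel_measurable (?P \<Otimes>\<^sub>M param_space \<Theta>)" by simp
  have "emeasure (distr (run_law \<Theta> I n D A) (?P \<Otimes>\<^sub>M param_space \<Theta>) ?h) X
      = (\<integral>\<^sup>+ w. indicator X w \<partial>distr (run_law \<Theta> I n D A) (?P \<Otimes>\<^sub>M param_space \<Theta>) ?h)"
    using X by simp
  also have "\<dots> = (\<integral>\<^sup>+ w. indicator X (?h w) \<partial>run_law \<Theta> I n D A)"
    using forget X' by (intro nn_integral_distr) (simp_all add: measurable_run_law[OF I(1)])
  also have "\<dots> = (\<integral>\<^sup>+ S. (\<integral>\<^sup>+ \<theta>. indicator X (restrict S {1..n}, \<theta>) \<partial>A (restrict S {1..n})) \<partial>(\<Pi>\<^sub>M i\<in>I. D))"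
    using measurable_compose[OF forget X'] by (subst nn_integral_run_law[OF I(1)]) auto
  also have "\<dots> = (\<integral>\<^sup>+ S. (\<integral>\<^sup>+ \<theta>. indicator X (S, \<theta>) \<partial>A S) \<partial>distr (\<Pi>\<^sub>M i\<in>I. D) ?P (\<lambda>S. restrict S {1..n}))"
    using inner_integral_measurable[OF X']
    by (intro nn_integral_distr[symmetric] measurable_restrict_subset I) (simp only: measurable_distr_eq1)
  also have "distr (\<Pi>\<^sub>M i\<in>I. D) ?P (\<lambda>S. restrict S {1..n}) = ?P"
  proof -
    interpret product_prob_space "\<lambda>_. D" I by standard
    show ?thesis using I by (intro distr_PiM_restrict_finite) auto
  qed
  also have "(\<integral>\<^sup>+ S. (\<integral>\<^sup>+ \<theta>. indicator X (S, \<theta>) \<partial>A S) \<partial>?P)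
      = (\<integral>\<^sup>+ S. (\<integral>\<^sup>+ \<theta>. indicator X (S, \<theta>) \<partial>A (restrict S {1..n})) \<partial>?P)"
    by (intro nn_integral_cong) (simp add: space_PiM)
  also have "\<dots> = (\<integral>\<^sup>+ w. indicator X w \<partial>run_law \<Theta> {1..n} n D A)"
    using nn_integral_run_law[OF subset_refl X'] by simp
  also have "\<dots> = emeasure (run_law \<Theta> {1..n} n D A) X"
    using X by (simp add: sets_run_law)
  finally show "emeasure (distr (run_law \<Theta> I n D A) (?P \<Otimes>\<^sub>M param_space \<Theta>) ?h) X = emeasure (run_law \<Theta> {1..n} n D A) X" .
qed (simp add: sets_run_law)

lemma integral_run_law_forget:
  fixes g :: "(nat \<Rightarrow> 'z) \<times> (nat \<Rightarrow> real) \<Rightarrow> real"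
  assumes I: "{1..n} \<subseteq> I" "finite I"
    and g: "g \<in> borel_measurable ((\<Pi>\<^sub>M i\<in>{1..n}. D) \<Otimes>\<^sub>M param_space \<Theta>)"
  shows "(\<integral>(S, \<theta>). g (restrict S {1..n}, \<theta>) \<partial>run_law \<Theta> I n D A) = (\<integral>w. g w \<partial>run_law \<Theta> {1..n} n D A)"
  unfolding run_law_forget[OF I, symmetric]
  using forget_measurable[OF I(1)] g
  by (subst integral_distr) (simp_all add: measurable_run_law[OF I(1)] case_prod_unfold)

text \<open>The algorithm never reads coordinate 0, so the fresh point is independent of the output
  and a bound for each fixed \<open>\<theta>\<close> is enough, in contrast with recall.\<close>

lemma nn_integral_fresh_le:
  assumes h: "h \<in> borel_measurable (D \<Otimes>\<^sub>M param_space \<Theta>)"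
    and le: "\<And>\<theta>. \<theta> \<in> \<Theta> \<Longrightarrow> (\<integral>\<^sup>+ z. h (z, \<theta>) \<partial>D) \<le> c"
  shows "(\<integral>\<^sup>+ (S, \<theta>). h (S 0, \<theta>) \<partial>run_law \<Theta> {0..n} n D A) \<le> c"
proof -
  have I: "{0..n} = insert 0 {1..n}" "{1..n} \<subseteq> {0..n}" by auto
  have h': "(\<lambda>(S, \<theta>). h (S 0, \<theta>)) \<in> borel_measurable ((\<Pi>\<^sub>M i\<in>{0..n}. D) \<Otimes>\<^sub>M param_space \<Theta>)"
    unfolding split_beta
    by (intro measurable_compose[OF _ h] measurable_Pair measurable_snd
      measurable_compose[OF measurable_fst measurable_component_singleton]) simp
  have m: "(\<lambda>S. \<integral>\<^sup>+ \<theta>. h (S 0, \<theta>) \<partial>A (restrict S {1..n})) \<in> borel_measurable (\<Pi>\<^sub>M i\<in>insert 0 {1..n}. D)"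
    using h' unfolding I(1)[symmetric]
    by (intro nn_integral_measurable_subprob_algebra2[OF _ measurable_prob_algebraD[OF A_restrict_measurable[OF I(2)]]]) simp
  have "(\<integral>\<^sup>+ (S, \<theta>). h (S 0, \<theta>) \<partial>run_law \<Theta> {0..n} n D A)
      = (\<integral>\<^sup>+ S. (\<integral>\<^sup>+ \<theta>. h (S 0, \<theta>) \<partial>A (restrict S {1..n})) \<partial>(\<Pi>\<^sub>M i\<in>insert 0 {1..n}. D))"
    using nn_integral_run_law[OF I(2) h'] by (simp add: I(1))
  also have "\<dots> = (\<integral>\<^sup>+ S. (\<integral>\<^sup>+ z. (\<integral>\<^sup>+ \<theta>. h ((S(0 := z)) 0, \<theta>) \<partial>A (restrict (S(0 := z)) {1..n})) \<partial>D) \<partial>(\<Pi>\<^sub>M i\<in>{1..n}. D))"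
    by (rule DD.product_nn_integral_insert[OF _ _ m]) auto
  also have "\<dots> = (\<integral>\<^sup>+ S. (\<integral>\<^sup>+ z. (\<integral>\<^sup>+ \<theta>. h (z, \<theta>) \<partial>A S) \<partial>D) \<partial>(\<Pi>\<^sub>M i\<in>{1..n}. D))"
  proof (intro nn_integral_cong)
    fix S z assume S: "S \<in> space (\<Pi>\<^sub>M i\<in>{1..n}. D)"
    then have "restrict (S(0 := z)) {1..n} = S" by (auto simp: space_PiM PiE_def extensional_def restrict_def)
    then show "(\<integral>\<^sup>+ \<theta>. h ((S(0 := z)) 0, \<theta>) \<partial>A (restrict (S(0 := z)) {1..n})) = (\<integral>\<^sup>+ \<theta>. h (z, \<theta>) \<partial>A S)" by simp
  qed
  also have "\<dots> \<le> (\<integral>\<^sup>+ S. c \<partial>(\<Pi>\<^sub>M i\<in>{1..n}. D))"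
  proof (rule nn_integral_mono)
    fix S assume S: "S \<in> space (\<Pi>\<^sub>M i\<in>{1..n}. D)"
    note A = output_law[OF S]
    interpret AS: prob_space "A S" by (rule A)
    interpret pair_sigma_finite D "A S" ..
    have "h \<in> borel_measurable (D \<Otimes>\<^sub>M A S)"
      using h by (simp add: A(2) cong: measurable_cong_sets sets_pair_measure_cong)
    \<comment> \<open>Swapping puts the integral over z inside, where the hypothesis on fixed
      parameters applies.\<close>
    then have "(\<integral>\<^sup>+ z. (\<integral>\<^sup>+ \<theta>. h (z, \<theta>) \<partial>A S) \<partial>D) = (\<integral>\<^sup>+ \<theta>. (\<integral>\<^sup>+ z. h (z, \<theta>) \<partial>D) \<partial>A S)"
      by (intro Fubini'[symmetric]) simp
    also have "\<dots> \<le> (\<integral>\<^sup>+ \<theta>. c \<partial>A S)" using A(3) by (intro nn_integral_mono le) auto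
    also have "\<dots> = c" by (simp add: AS.emeasure_space_1)
    finally show "(\<integral>\<^sup>+ z. (\<integral>\<^sup>+ \<theta>. h (z, \<theta>) \<partial>A S) \<partial>D) \<le> c" .
  qed
  also have "\<dots> = c"
    using prob_space.emeasure_space_1[OF prob_space_PiM[of "{1..n}" "\<lambda>_. D"]] D.prob_space_axioms by simp
  finally show ?thesis .
qed

end

section \<open>Subgaussian tracers\<close>

lemma convex_body_nonempty: "convex_body d \<Theta> \<Longrightarrow> \<Theta> \<noteq> {}"
  by (auto simp: convex_body_def)

text \<open>The diameter is a real supremum, so a bound from above is needed even for its
  nonnegativity. The upper bound justifies scale 3 for single values, the lower one serves the zero
  tracer.\<close>

lemma diam_wrt_bounds:
  assumes "convex_body d \<Theta>"
  shows "diam_wrt (Theta_norm \<Theta>) \<Theta> \<le> 2" "0 \<le> diam_wrt (Theta_norm \<Theta>) \<Theta>"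
proof -
  obtain b B where "equivalent_seminorm d (Theta_norm \<Theta>) b B"
    using Theta_norm_equivalent_seminorm[OF assms] .
  then interpret equivalent_seminorm d "Theta_norm \<Theta>" b B .
  have \<Theta>: "\<Theta> \<subseteq> Rspace d" using assms by (simp add: convex_body_def)
  obtain x where x: "x \<in> \<Theta>" using convex_body_nonempty[OF assms] by blast
  have bound: "Theta_norm \<Theta> (s - t) \<le> 2" if "s \<in> \<Theta>" "t \<in> \<Theta>" for s t
  proof -
    have "Theta_norm \<Theta> (s - t) \<le> Theta_norm \<Theta> s + Theta_norm \<Theta> t"
      using that \<Theta> by (intro triangle_diff) auto
    then show ?thesis using Theta_norm_le_1[OF that(1)] Theta_norm_le_1[OF that(2)] by linarith
  qed
  then show "diam_wrt (Theta_norm \<Theta>) \<Theta> \<le> 2"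
    unfolding diam_wrt_def using x by (intro cSUP_least) auto
  have "Theta_norm \<Theta> (x - x) \<le> (SUP q\<in>\<Theta> \<times> \<Theta>. case q of (s, t) \<Rightarrow> Theta_norm \<Theta> (s - t))"
  proof (rule cSUP_upper2)
    show "bdd_above ((\<lambda>q. case q of (s, t) \<Rightarrow> Theta_norm \<Theta> (s - t)) ` (\<Theta> \<times> \<Theta>))"
      using bound by (intro bdd_aboveI2[where M = 2]) auto
    show "(x, x) \<in> \<Theta> \<times> \<Theta>" using x by simp
  qed simp
  then show "0 \<le> diam_wrt (Theta_norm \<Theta>) \<Theta>" using zero by (simp only: diam_wrt_def diff_self)
qed

lemma psi2_norm_zero: "prob_space M \<Longrightarrow> psi2_norm M (\<lambda>_. 0) \<le> 0"
proof -
  assume "prob_space M"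
  then interpret prob_space M .
  have "psi2_norm M (\<lambda>_. 0) \<le> ereal e" if "0 < e" for e :: real
    unfolding psi2_norm_def using that by (intro Inf_lower) (simp add: emeasure_space_1)
  then show ?thesis by - (rule ereal_le_epsilon2, simp)
qed

text \<open>By \<open>Theta_norm_le_1\<close> the set \<open>\<Theta>\<close> lies in the unit ball
  of its own norm, the normalisation under which the net sizes hold.\<close>

lemma subgaussian_tracer_chain:
  assumes "convex_body d \<Theta>" "(\<phi>, D) \<in> subgaussian_tracers \<kappa> \<Theta> Z"
  obtains b B N proj where "subgaussian_chain d (Theta_norm \<Theta>) b B \<Theta> N proj D \<phi>"
proof -
  obtain b B where B: "equivalent_seminorm d (Theta_norm \<Theta>) b B"
    using Theta_norm_equivalent_seminorm[OF assms(1)] .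
  then interpret equivalent_seminorm d "Theta_norm \<Theta>" b B .
  have \<Theta>: "\<Theta> \<subseteq> Rspace d" using assms by (simp add: convex_body_def)
  obtain N proj where "net_sequence d (Theta_norm \<Theta>) b B \<Theta> N proj"
    using net_sequence_exists[OF \<Theta> Theta_norm_le_1] .
  then interpret net_sequence d "Theta_norm \<Theta>" b B \<Theta> N proj .
  have T: "D \<in> space (prob_algebra Z)" "subgaussian_process 1 \<Theta> (Theta_norm \<Theta>) D \<phi>" "separable_process \<Theta> D \<phi>"
    using assms(2) by (auto simp: subgaussian_tracers_def tracer_def)
  interpret prob_space D using T(1) by (simp add: space_prob_algebra)
  have "subgaussian_chain d (Theta_norm \<Theta>) b B \<Theta> N proj D \<phi>"
  proof
    show "\<phi> s \<in> borel_measurable D" if "s \<in> \<Theta>" for s using T(2) that by (auto simp: subgaussian_process_def)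
    show "(\<integral>\<^sup>+ w. ennreal (exp (((\<phi> s w - \<phi> t w) / \<tau>)\<^sup>2)) \<partial>D) \<le> 2"
      if "s \<in> \<Theta>" "t \<in> \<Theta>" "Theta_norm \<Theta> (s - t) < \<tau>" for s t \<tau>
    proof (rule psi2_norm_bound[of D _ "Theta_norm \<Theta> (s - t)"])
      show "0 < \<tau>" using nonneg[of "s - t"] that \<Theta> by (auto intro!: Rspace_closed intro: le_less_trans)
    qed (use T(2) that in \<open>auto simp: subgaussian_process_def\<close>)
    show "(\<integral>\<^sup>+ w. ennreal (exp ((\<phi> s w / 3)\<^sup>2)) \<partial>D) \<le> 2" if "s \<in> \<Theta>" for s
      using T(2) that diam_wrt_bounds(1)[OF assms(1)]
      by (intro psi2_norm_bound[of D _ "diam_wrt (Theta_norm \<Theta>) \<Theta>"]) (auto simp: subgaussian_process_def)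
    show "separable_process \<Theta> D \<phi>" by fact
  qed
  then show thesis by (rule that)
qed

section \<open>Measurability and integrals over runs\<close>

context algorithm_run
begin

lemma joint_measurable:
  assumes "(\<lambda>(\<theta>, z). \<phi> \<theta> z) \<in> borel_measurable (param_space \<Theta> \<Otimes>\<^sub>M Z)" "i \<in> I"
  shows "(\<lambda>(S, \<theta>). \<phi> \<theta> (S i)) \<in> borel_measurable ((\<Pi>\<^sub>M i\<in>I. D) \<Otimes>\<^sub>M param_space \<Theta>)"
proof -
  have "(\<lambda>w. fst w i) \<in> (\<Pi>\<^sub>M i\<in>I. D) \<Otimes>\<^sub>M param_space \<Theta> \<rightarrow>\<^sub>M Z"
    using measurable_compose[OF measurable_fst measurable_component_singleton[OF assms(2), of "\<lambda>_. D"]]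
    by (simp add: measurable_cong_sets[OF refl sets_D])
  then have "(\<lambda>w. (snd w, fst w i)) \<in> (\<Pi>\<^sub>M i\<in>I. D) \<Otimes>\<^sub>M param_space \<Theta> \<rightarrow>\<^sub>M param_space \<Theta> \<Otimes>\<^sub>M Z"
    by (intro measurable_Pair measurable_snd)
  from measurable_compose[OF this assms(1)] show ?thesis by (simp add: case_prod_unfold)
qed

lemma section_measurable:
  assumes "(\<lambda>(\<theta>, z). \<phi> \<theta> z) \<in> borel_measurable (param_space \<Theta> \<Otimes>\<^sub>M Z)"
  shows "(\<lambda>(z, \<theta>). \<phi> \<theta> z) \<in> borel_measurable (D \<Otimes>\<^sub>M param_space \<Theta>)"
proof -
  have "(\<lambda>w. (snd w, fst w)) \<in> D \<Otimes>\<^sub>M param_space \<Theta> \<rightarrow>\<^sub>M param_space \<Theta> \<Otimes>\<^sub>M Z"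
    using measurable_fst[of D "param_space \<Theta>"]
    by (intro measurable_Pair measurable_snd) (simp add: measurable_cong_sets[OF refl sets_D])
  from measurable_compose[OF this assms] show ?thesis by (simp add: case_prod_unfold)
qed

lemma soundness_le:
  fixes \<phi> :: "(nat \<Rightarrow> real) \<Rightarrow> 'z \<Rightarrow> real"
  assumes \<phi>: "(\<lambda>(\<theta>, z). \<phi> \<theta> z) \<in> borel_measurable (param_space \<Theta> \<Otimes>\<^sub>M Z)" and "0 \<le> c"
    and le: "\<And>\<theta>. \<theta> \<in> \<Theta> \<Longrightarrow> (\<integral>\<^sup>+ z. indicator {l..} (\<phi> \<theta> z) \<partial>D) \<le> ennreal c"
  shows "\<P>((S, \<theta>) in run_law \<Theta> {0..n} n D A. l \<le> \<phi> \<theta> (S 0)) \<le> c"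
proof -
  let ?R = "run_law \<Theta> {0..n} n D A"
  have I: "{1..n} \<subseteq> {0..n}" by auto
  interpret R: prob_space ?R by (rule prob_space_run_law[OF I])
  have m: "(\<lambda>(S, \<theta>). \<phi> \<theta> (S 0)) \<in> borel_measurable ?R"
    unfolding measurable_run_law[OF I] by (rule joint_measurable[OF \<phi>]) simp
  define E where "E = {w \<in> space ?R. case w of (S, \<theta>) \<Rightarrow> l \<le> \<phi> \<theta> (S 0)}"
  have "E = (\<lambda>(S, \<theta>). \<phi> \<theta> (S 0)) -` {l..} \<inter> space ?R" by (auto simp: E_def)
  then have E: "E \<in> sets ?R" using measurable_sets[OF m, of "{l..}"] by simp
  have "emeasure ?R E = (\<integral>\<^sup>+ w. indicator E w \<partial>?R)" using E by simp
  also have "\<dots> = (\<integral>\<^sup>+ (S, \<theta>). indicator {l..} (\<phi> \<theta> (S 0)) \<partial>?R)"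
    by (intro nn_integral_cong) (auto simp: E_def split: split_indicator)
  also have "\<dots> = (\<integral>\<^sup>+ (S, \<theta>). (\<lambda>(z, \<theta>). indicator {l..} (\<phi> \<theta> z)) (S 0, \<theta>) \<partial>?R)" by simp
  also have "\<dots> \<le> ennreal c"
  proof (rule nn_integral_fresh_le)
    show "(\<lambda>(z, \<theta>). indicator {l..} (\<phi> \<theta> z)) \<in> borel_measurable (D \<Otimes>\<^sub>M param_space \<Theta>)"
      using measurable_compose[OF section_measurable[OF \<phi>], of "indicator {l..}" borel] by (simp add: case_prod_unfold)
  qed (use le in simp)
  finally have "R.prob E \<le> c" using assms(2) by (simp add: R.emeasure_eq_measure)
  moreover have "E = {(S, \<theta>). (S, \<theta>) \<in> space ?R \<and> l \<le> \<phi> \<theta> (S 0)}" unfolding E_def by auto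
  ultimately show ?thesis by simp
qed

text \<open>A sum of indicators makes measurability and the mean of the hit count immediate.\<close>

definition count_hits :: "((nat \<Rightarrow> real) \<Rightarrow> 'z \<Rightarrow> real) \<Rightarrow> real \<Rightarrow> (nat \<Rightarrow> 'z) \<times> (nat \<Rightarrow> real) \<Rightarrow> real" where
  "count_hits \<phi> l = (\<lambda>(S, \<theta>). \<Sum>i=1..n. indicator {l..} (\<phi> \<theta> (S i)))"

lemma card_eq_count_hits: "real (card {i \<in> {1..n}. l \<le> \<phi> \<theta> (S i)}) = count_hits \<phi> l (S, \<theta>)"
proof -
  have "count_hits \<phi> l (S, \<theta>) = (\<Sum>i\<in>{1..n}. if l \<le> \<phi> \<theta> (S i) then 1 else 0)"
    unfolding count_hits_def by (auto intro!: sum.cong split: split_indicator)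
  also have "\<dots> = real (card {i \<in> {1..n}. l \<le> \<phi> \<theta> (S i)})" by (simp add: sum.If_cases Int_def)
  finally show ?thesis by simp
qed

lemma count_hits_measurable:
  assumes \<phi>: "(\<lambda>(\<theta>, z). \<phi> \<theta> z) \<in> borel_measurable (param_space \<Theta> \<Otimes>\<^sub>M Z)"
  shows "count_hits \<phi> l \<in> borel_measurable ((\<Pi>\<^sub>M i\<in>{1..n}. D) \<Otimes>\<^sub>M param_space \<Theta>)"
proof -
  have "(\<lambda>w. \<Sum>i=1..n. indicator {l..} (case w of (S, \<theta>) \<Rightarrow> \<phi> \<theta> (S i)) :: real)
      \<in> borel_measurable ((\<Pi>\<^sub>M i\<in>{1..n}. D) \<Otimes>\<^sub>M param_space \<Theta>)"
    by (intro borel_measurable_sum measurable_compose[OF joint_measurable[OF \<phi>]]) auto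
  then show ?thesis by (simp add: count_hits_def case_prod_unfold)
qed

lemma expected_card_eq:
  assumes \<phi>: "(\<lambda>(\<theta>, z). \<phi> \<theta> z) \<in> borel_measurable (param_space \<Theta> \<Otimes>\<^sub>M Z)"
  shows "(\<integral>(S, \<theta>). real (card {i \<in> {1..n}. l \<le> \<phi> \<theta> (S i)}) \<partial>run_law \<Theta> {0..n} n D A)
    = (\<integral>w. count_hits \<phi> l w \<partial>run_law \<Theta> {1..n} n D A)"
proof -
  have "(\<integral>(S, \<theta>). real (card {i \<in> {1..n}. l \<le> \<phi> \<theta> (S i)}) \<partial>run_law \<Theta> {0..n} n D A)
      = (\<integral>(S, \<theta>). count_hits \<phi> l (restrict S {1..n}, \<theta>) \<partial>run_law \<Theta> {0..n} n D A)"
    unfolding card_eq_count_hits by (intro Bochner_Integration.integral_cong refl) (auto simp: count_hits_def)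
  also have "\<dots> = (\<integral>w. count_hits \<phi> l w \<partial>run_law \<Theta> {1..n} n D A)"
    by (intro integral_run_law_forget count_hits_measurable \<phi>) auto
  finally show ?thesis .
qed

lemma integrable_run_law_bounded:
  fixes g :: "(nat \<Rightarrow> 'z) \<times> (nat \<Rightarrow> real) \<Rightarrow> real"
  assumes "g \<in> borel_measurable ((\<Pi>\<^sub>M i\<in>{1..n}. D) \<Otimes>\<^sub>M param_space \<Theta>)"
    and "\<And>S \<theta>. S \<in> space (\<Pi>\<^sub>M i\<in>{1..n}. D) \<Longrightarrow> \<theta> \<in> \<Theta> \<Longrightarrow> \<bar>g (S, \<theta>)\<bar> \<le> c"
  shows "integrable (run_law \<Theta> {1..n} n D A) g"
proof -
  interpret R: prob_space "run_law \<Theta> {1..n} n D A" by (rule prob_space_run_law) simp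
  show ?thesis
    using assms by (intro R.integrable_const_bound[where B = c] AE_I2) (auto simp: space_run_law measurable_run_law)
qed

lemma count_hits_bounds: "0 \<le> count_hits \<phi> l w" "\<bar>count_hits \<phi> l w\<bar> \<le> real n"
proof -
  show *: "0 \<le> count_hits \<phi> l w" by (auto simp: count_hits_def split_beta intro: sum_nonneg)
  have "count_hits \<phi> l w \<le> (\<Sum>i=1..n. 1)"
    unfolding count_hits_def split_beta by (intro sum_mono) (auto split: split_indicator)
  then show "\<bar>count_hits \<phi> l w\<bar> \<le> real n" using * by simp
qed

lemma square_sum_measurable:
  assumes \<phi>: "(\<lambda>(\<theta>, z). \<phi> \<theta> z) \<in> borel_measurable (param_space \<Theta> \<Otimes>\<^sub>M Z)"
  shows "(\<lambda>(S, \<theta>). \<Sum>i=1..n. (\<phi> \<theta> (S i))\<^sup>2 :: real) \<in> borel_measurable ((\<Pi>\<^sub>M i\<in>{1..n}. D) \<Otimes>\<^sub>M param_space \<Theta>)"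
proof -
  have "(\<lambda>w. \<Sum>i=1..n. (case w of (S, \<theta>) \<Rightarrow> \<phi> \<theta> (S i))\<^sup>2 :: real)
      \<in> borel_measurable ((\<Pi>\<^sub>M i\<in>{1..n}. D) \<Otimes>\<^sub>M param_space \<Theta>)"
    by (intro borel_measurable_sum borel_measurable_power joint_measurable[OF \<phi>])
  then show ?thesis by (simp add: case_prod_unfold)
qed

lemma sum_measurable:
  assumes \<phi>: "(\<lambda>(\<theta>, z). \<phi> \<theta> z) \<in> borel_measurable (param_space \<Theta> \<Otimes>\<^sub>M Z)"
  shows "(\<lambda>(S, \<theta>). 1 / real n * (\<Sum>i=1..n. \<phi> \<theta> (S i)) :: real) \<in> borel_measurable ((\<Pi>\<^sub>M i\<in>{1..n}. D) \<Otimes>\<^sub>M param_space \<Theta>)"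
proof -
  have "(\<lambda>w. 1 / real n * (\<Sum>i=1..n. (case w of (S, \<theta>) \<Rightarrow> \<phi> \<theta> (S i))) :: real)
      \<in> borel_measurable ((\<Pi>\<^sub>M i\<in>{1..n}. D) \<Otimes>\<^sub>M param_space \<Theta>)"
    by (intro borel_measurable_times borel_measurable_const borel_measurable_sum joint_measurable[OF \<phi>])
  then show ?thesis by (simp add: case_prod_unfold)
qed

lemma mean_bound:
  assumes "\<And>\<theta> z. \<theta> \<in> \<Theta> \<Longrightarrow> z \<in> space Z \<Longrightarrow> \<bar>\<phi> \<theta> z\<bar> \<le> \<kappa>" "0 \<le> \<kappa>"
    and "S \<in> space (\<Pi>\<^sub>M i\<in>{1..n}. D)" "\<theta> \<in> \<Theta>"
  shows "\<bar>1 / real n * (\<Sum>i=1..n. \<phi> \<theta> (S i))\<bar> \<le> \<kappa>"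
proof -
  have "\<bar>\<Sum>i=1..n. \<phi> \<theta> (S i)\<bar> \<le> (\<Sum>i=1..n. \<bar>\<phi> \<theta> (S i)\<bar>)" by (rule sum_abs)
  also have "\<dots> \<le> (\<Sum>i=1..n. \<kappa>)"
    using assms by (intro sum_mono assms(1)) (auto simp: space_PiM PiE_def Pi_def space_D)
  finally have "\<bar>\<Sum>i=1..n. \<phi> \<theta> (S i)\<bar> \<le> real n * \<kappa>" by simp
  \<comment> \<open>For n = 0 the mean is 0, as \<open>1 / 0 = 0\<close>.\<close>
  then show ?thesis using assms(2) by (cases "n = 0") (simp_all add: abs_mult field_simps)
qed

lemma nn_integral_sample_run:
  assumes f: "f \<in> borel_measurable D" and i: "i \<in> {1..n}"
  shows "(\<integral>\<^sup>+ (S, \<theta>). f (S i) \<partial>run_law \<Theta> {1..n} n D A) = (\<integral>\<^sup>+ z. f z \<partial>D)"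
proof -
  let ?P = "\<Pi>\<^sub>M i\<in>{1..n}. D"
  have c: "(\<lambda>S. S i) \<in> ?P \<rightarrow>\<^sub>M D" by (rule measurable_component_singleton[OF i])
  have "(\<lambda>(S, \<theta>). f (S i)) \<in> borel_measurable (?P \<Otimes>\<^sub>M param_space \<Theta>)"
    unfolding case_prod_unfold by (rule measurable_compose[OF measurable_compose[OF measurable_fst c] f])
  from nn_integral_run_law[OF subset_refl this]
  have "(\<integral>\<^sup>+ (S, \<theta>). f (S i) \<partial>run_law \<Theta> {1..n} n D A)
      = (\<integral>\<^sup>+ S. (\<integral>\<^sup>+ \<theta>. f (S i) \<partial>A (restrict S {1..n})) \<partial>?P)" by simp
  also have "\<dots> = (\<integral>\<^sup>+ S. f (S i) \<partial>?P)"
  proof (rule nn_integral_cong)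
    fix S assume S: "S \<in> space ?P"
    interpret prob_space "A (restrict S {1..n})"
      by (rule output_law(1)[OF restrict_in_space[OF subset_refl S]])
    show "(\<integral>\<^sup>+ \<theta>. f (S i) \<partial>A (restrict S {1..n})) = f (S i)" by (simp only: nn_integral_const emeasure_space_1 mult_1_right)
  qed
  also have "\<dots> = (\<integral>\<^sup>+ z. f z \<partial>distr ?P D (\<lambda>S. S i))"
    by (rule nn_integral_distr[symmetric, OF c]) (use f in simp)
  also have "distr ?P D (\<lambda>S. S i) = D"
    using distr_PiM_component[of "{1..n}" "\<lambda>_. D" i] i D.prob_space_axioms by simp
  finally show ?thesis .
qed

end

text \<open>\<open>sample_bound\<close> does not involve the output, so averaging over the output
  distribution leaves it unchanged.\<close>

lemma (in algorithm_run) second_moment: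
  assumes "subgaussian_chain d p b B \<Theta> N proj D \<phi>"
    and \<phi>: "(\<lambda>(\<theta>, z). \<phi> \<theta> z) \<in> borel_measurable (param_space \<Theta> \<Otimes>\<^sub>M Z)" and "1 \<le> n"
  shows "(\<integral>\<^sup>+ (S, \<theta>). ennreal (\<Sum>i=1..n. (\<phi> \<theta> (S i))\<^sup>2) \<partial>run_law \<Theta> {1..n} n D A) \<le> ennreal (600 * (real n + real d))"
proof -
  interpret subgaussian_chain d p b B \<Theta> N proj D \<phi> by fact
  let ?P = "\<Pi>\<^sub>M i\<in>{1..n}. D"
  have m: "(\<lambda>(S, \<theta>). ennreal (\<Sum>i=1..n. (\<phi> \<theta> (S i))\<^sup>2)) \<in> borel_measurable (?P \<Otimes>\<^sub>M param_space \<Theta>)"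
    using measurable_compose[OF square_sum_measurable[OF \<phi>] measurable_ennreal] by (simp add: case_prod_unfold)
  have "(\<integral>\<^sup>+ (S, \<theta>). ennreal (\<Sum>i=1..n. (\<phi> \<theta> (S i))\<^sup>2) \<partial>run_law \<Theta> {1..n} n D A)
      = (\<integral>\<^sup>+ S. (\<integral>\<^sup>+ \<theta>. ennreal (\<Sum>i=1..n. (\<phi> \<theta> (S i))\<^sup>2) \<partial>A (restrict S {1..n})) \<partial>?P)"
    using nn_integral_run_law[OF subset_refl m] by simp
  also have "\<dots> \<le> (\<integral>\<^sup>+ S. sample_bound n S \<partial>?P)"
  proof (rule nn_integral_mono_AE, rule AE_mp[OF AE_square_sum_le_sample_bound[of n]], rule AE_I2, rule impI)
    fix S assume S: "S \<in> space ?P"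
      and le: "\<forall>\<theta>\<in>\<Theta>. ennreal (\<Sum>i=1..n. (\<phi> \<theta> (S i))\<^sup>2) \<le> sample_bound n S"
    note A = output_law[OF restrict_in_space[OF subset_refl S]]
    interpret AS: prob_space "A (restrict S {1..n})" by (rule A)
    have "(\<integral>\<^sup>+ \<theta>. ennreal (\<Sum>i=1..n. (\<phi> \<theta> (S i))\<^sup>2) \<partial>A (restrict S {1..n}))
        \<le> (\<integral>\<^sup>+ \<theta>. sample_bound n S \<partial>A (restrict S {1..n}))"
      by (rule nn_integral_mono) (use le A(3) in blast)
    also have "\<dots> = sample_bound n S" by (simp only: nn_integral_const AS.emeasure_space_1 mult_1_right)
    finally show "(\<integral>\<^sup>+ \<theta>. ennreal (\<Sum>i=1..n. (\<phi> \<theta> (S i))\<^sup>2) \<partial>A (restrict S {1..n})) \<le> sample_bound n S" .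
  qed
  also have "\<dots> \<le> ennreal (600 * (real n + real d))" by (rule nn_integral_sample_bound[OF assms(3)])
  finally show ?thesis .
qed

lemma (in prob_space) affine_integral_le:
  fixes f g h :: "'a \<Rightarrow> real"
  assumes "integrable M f" "integrable M g" "integrable M h" "\<And>w. r * f w \<le> a + b * g w + c * h w"
  shows "r * (\<integral>w. f w \<partial>M) \<le> a + b * (\<integral>w. g w \<partial>M) + c * (\<integral>w. h w \<partial>M)"
proof -
  have "r * (\<integral>w. f w \<partial>M) = (\<integral>w. r * f w \<partial>M)" by simp
  also have "\<dots> \<le> (\<integral>w. a + b * g w + c * h w \<partial>M)" using assms by (intro integral_mono) auto
  also have "\<dots> = a + b * (\<integral>w. g w \<partial>M) + c * (\<integral>w. h w \<partial>M)" using assms by (simp add: prob_space)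
  finally show ?thesis .
qed

lemma (in algorithm_run) recall_ge:
  assumes chain: "subgaussian_chain d p b B \<Theta> N proj D \<phi>"
    and \<phi>: "(\<lambda>(\<theta>, z). \<phi> \<theta> z) \<in> borel_measurable (param_space \<Theta> \<Otimes>\<^sub>M Z)"
    and bound: "\<And>\<theta> z. \<theta> \<in> \<Theta> \<Longrightarrow> z \<in> space Z \<Longrightarrow> \<bar>\<phi> \<theta> z\<bar> \<le> \<kappa>" "0 \<le> \<kappa>"
    and n: "1 \<le> n" and T: "0 < T"
    and mean: "T / 2 \<le> (\<integral>(S, \<theta>). 1 / real n * (\<Sum>i=1..n. \<phi> \<theta> (S i)) \<partial>run_law \<Theta> {1..n} n D A)"
  shows "(real n)\<^sup>2 * T\<^sup>2 / (9600 * (real n + real d))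
    \<le> (\<integral>w. count_hits \<phi> (T / 4) w \<partial>run_law \<Theta> {1..n} n D A)"
proof -
  let ?R = "run_law \<Theta> {1..n} n D A"
  interpret R: prob_space ?R by (rule prob_space_run_law) simp
  define f where "f = (\<lambda>(S, \<theta>). 1 / real n * (\<Sum>i=1..n. \<phi> \<theta> (S i)))"
  define q where "q = (\<lambda>(S, \<theta>). \<Sum>i=1..n. (\<phi> \<theta> (S i))\<^sup>2)"
  define h where "h = count_hits \<phi> (T / 4)"
  define C where "C = 600 * (real n + real d)"
  define \<eta> where "\<eta> = real n * T / (4 * C)"
  have C: "0 < C" using n by (simp add: C_def)
  have \<eta>: "0 < \<eta>" using n T C by (simp add: \<eta>_def)
  have int_f: "integrable ?R f"
  proof (rule integrable_run_law_bounded)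
    show "f \<in> borel_measurable ((\<Pi>\<^sub>M i\<in>{1..n}. D) \<Otimes>\<^sub>M param_space \<Theta>)"
      unfolding f_def by (rule sum_measurable[OF \<phi>])
    show "\<bar>f (S, \<theta>)\<bar> \<le> \<kappa>" if "S \<in> space (\<Pi>\<^sub>M i\<in>{1..n}. D)" "\<theta> \<in> \<Theta>" for S \<theta>
      unfolding f_def case_prod_conv by (rule mean_bound[OF bound that])
  qed
  have int_h: "integrable ?R h"
    unfolding h_def by (rule integrable_run_law_bounded[OF count_hits_measurable[OF \<phi>] count_hits_bounds(2)])
  have q_bound: "\<bar>q (S, \<theta>)\<bar> \<le> real n * \<kappa>\<^sup>2" if "S \<in> space (\<Pi>\<^sub>M i\<in>{1..n}. D)" "\<theta> \<in> \<Theta>" for S \<theta>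
  proof -
    have "(\<phi> \<theta> (S i))\<^sup>2 \<le> \<kappa>\<^sup>2" if "i \<in> {1..n}" for i
    proof -
      have "S i \<in> space Z" using \<open>S \<in> _\<close> that by (auto simp: space_PiM PiE_def Pi_def space_D)
      then show ?thesis using bound \<open>\<theta> \<in> \<Theta>\<close> by (metis abs_ge_zero power2_abs power_mono)
    qed
    then have "q (S, \<theta>) \<le> (\<Sum>i=1..n. \<kappa>\<^sup>2)" unfolding q_def case_prod_conv by (rule sum_mono)
    moreover have "0 \<le> q (S, \<theta>)" by (simp add: q_def sum_nonneg)
    ultimately show ?thesis by simp
  qed
  have int_q: "integrable ?R q"
  proof (rule integrable_run_law_bounded)
    show "q \<in> borel_measurable ((\<Pi>\<^sub>M i\<in>{1..n}. D) \<Otimes>\<^sub>M param_space \<Theta>)"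
      unfolding q_def by (rule square_sum_measurable[OF \<phi>])
  qed (rule q_bound)
  have "ennreal (\<integral>w. q w \<partial>?R) = (\<integral>\<^sup>+ w. ennreal (q w) \<partial>?R)"
    by (rule nn_integral_eq_integral[symmetric, OF int_q]) (auto simp: q_def intro!: AE_I2 sum_nonneg)
  also have "\<dots> \<le> ennreal C"
    using second_moment[OF chain \<phi> n] by (simp add: q_def C_def case_prod_unfold)
  finally have q_le: "(\<integral>w. q w \<partial>?R) \<le> C" using C by simp
  have pointwise: "real n * f w \<le> real n * T / 4 + \<eta> / 2 * q w + h w / (2 * \<eta>)" for w
  proof -
    obtain S \<theta> where w: "w = (S, \<theta>)" by (cases w)
    \<comment> \<open>AM-GM, with \<open>\<eta>\<close> chosen so that the second moment consumes half of the surplus \<open>n T / 4\<close>\<close>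
    have "x \<le> T / 4 + \<eta> / 2 * x\<^sup>2 + indicator {T / 4..} x / (2 * \<eta>)" for x
    proof (cases "T / 4 \<le> x")
      case True
      have "0 \<le> (\<eta> * x - 1)\<^sup>2 / (2 * \<eta>)" using \<eta> by simp
      also have "\<dots> = \<eta> / 2 * x\<^sup>2 + 1 / (2 * \<eta>) - x"
        using \<eta> by (simp add: power2_eq_square field_simps)
      finally show ?thesis using True T by simp
    qed (use \<eta> in \<open>simp add: add_increasing2\<close>)
    then have "(\<Sum>i=1..n. \<phi> \<theta> (S i))
        \<le> (\<Sum>i=1..n. T / 4 + \<eta> / 2 * (\<phi> \<theta> (S i))\<^sup>2 + indicator {T / 4..} (\<phi> \<theta> (S i)) / (2 * \<eta>))"
      by (intro sum_mono)
    also have "\<dots> = real n * T / 4 + \<eta> / 2 * q w + h w / (2 * \<eta>)"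
      by (simp add: w q_def h_def count_hits_def sum.distrib sum_distrib_left sum_divide_distrib)
    finally show ?thesis using n by (simp add: f_def w)
  qed
  have "real n * (T / 2) \<le> real n * (\<integral>w. f w \<partial>?R)"
    using mean unfolding f_def by (intro mult_left_mono) auto
  also have "\<dots> \<le> real n * T / 4 + \<eta> / 2 * (\<integral>w. q w \<partial>?R) + 1 / (2 * \<eta>) * (\<integral>w. h w \<partial>?R)"
    using pointwise by (intro R.affine_integral_le int_f int_q int_h) simp
  also have "\<dots> \<le> real n * T / 4 + \<eta> / 2 * C + 1 / (2 * \<eta>) * (\<integral>w. h w \<partial>?R)"
    using q_le \<eta> by (intro add_mono mult_left_mono) auto
  finally have "real n * (T / 2) \<le> real n * T / 4 + \<eta> / 2 * C + 1 / (2 * \<eta>) * (\<integral>w. h w \<partial>?R)" .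
  moreover have "\<eta> / 2 * C = real n * T / 8" using C by (simp add: \<eta>_def)
  moreover have "real n * (T / 2) = real n * T / 2" by simp
  ultimately have "real n * T / 8 \<le> 1 / (2 * \<eta>) * (\<integral>w. h w \<partial>?R)" by linarith
  then have "\<eta> * real n * T / 4 \<le> (\<integral>w. h w \<partial>?R)" using \<eta> by (simp add: field_simps)
  \<comment> \<open>With C = 600 * (n + d) the left side is n^2 T^2 / (16 C), and 9600 = 16 *
    600.\<close>
  moreover have "\<eta> * real n * T / 4 = (real n)\<^sup>2 * T\<^sup>2 / (9600 * (real n + real d))"
    by (simp add: \<eta>_def C_def power2_eq_square)
  ultimately show ?thesis by (simp add: h_def)
qed

text \<open>Markov's inequality for the exponential of the squared value at scale 3.\<close>

lemma (in subgaussian_chain) tail_bound: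
  assumes "\<theta> \<in> \<Theta>" "0 \<le> l"
  shows "(\<integral>\<^sup>+ z. indicator {l..} (X \<theta> z) \<partial>M) \<le> ennreal (2 * exp (- (l\<^sup>2 / 9)))"
proof -
  have [measurable]: "X \<theta> \<in> borel_measurable M" by (rule X_measurable[OF assms(1)])
  have "(\<integral>\<^sup>+ z. indicator {l..} (X \<theta> z) \<partial>M) \<le> (\<integral>\<^sup>+ z. ennreal (exp (- (l\<^sup>2 / 9))) * ennreal (exp ((X \<theta> z / 3)\<^sup>2)) \<partial>M)"
  proof (rule nn_integral_mono)
    fix z
    show "indicator {l..} (X \<theta> z) \<le> ennreal (exp (- (l\<^sup>2 / 9))) * ennreal (exp ((X \<theta> z / 3)\<^sup>2))"
    proof (cases "l \<le> X \<theta> z")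
      case True
      then have "l\<^sup>2 / 9 \<le> (X \<theta> z / 3)\<^sup>2" using assms(2) by (simp add: power_divide power_mono)
      then have "1 \<le> exp (- (l\<^sup>2 / 9)) * exp ((X \<theta> z / 3)\<^sup>2)" by (simp flip: exp_add)
      then show ?thesis using True by (simp flip: ennreal_mult)
    qed simp
  qed
  also have "\<dots> = ennreal (exp (- (l\<^sup>2 / 9))) * (\<integral>\<^sup>+ z. ennreal (exp ((X \<theta> z / 3)\<^sup>2)) \<partial>M)"
    by (rule nn_integral_cmult) measurable
  also have "\<dots> \<le> ennreal (exp (- (l\<^sup>2 / 9))) * ennreal 2"
    using single[OF assms(1)] by (intro mult_left_mono) auto
  also have "\<dots> = ennreal (2 * exp (- (l\<^sup>2 / 9)))" by (subst ennreal_mult[symmetric]) (auto simp: mult.commute)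
  finally show ?thesis .
qed

lemma traceable_large:
  assumes \<Theta>: "convex_body d \<Theta>" and A: "algorithm \<Theta> Z n A"
    and tr: "(\<phi>, D) \<in> subgaussian_tracers \<kappa> \<Theta> Z" and \<kappa>: "0 \<le> \<kappa>" and n: "1 \<le> n"
    and T: "0 < T" "288 \<le> T\<^sup>2"
    and mean: "T / 2 \<le> (\<integral>(S, \<theta>). 1 / real n * (\<Sum>i=1..n. \<phi> \<theta> (S i)) \<partial>run_law \<Theta> {1..n} n D A)"
  shows "traceable \<Theta> Z n A (exp (- (T\<^sup>2 / 288))) ((real n)\<^sup>2 * T\<^sup>2 / (9600 * (real n + real d)))"
proof -
  have trD: "tracer \<Theta> Z \<phi> D" "\<And>\<theta> z. \<theta> \<in> \<Theta> \<Longrightarrow> z \<in> space Z \<Longrightarrow> \<bar>\<phi> \<theta> z\<bar> \<le> \<kappa>"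
    using tr by (auto simp: subgaussian_tracers_def)
  then have \<phi>: "(\<lambda>(\<theta>, z). \<phi> \<theta> z) \<in> borel_measurable (param_space \<Theta> \<Otimes>\<^sub>M Z)" by (simp add: tracer_def)
  interpret algorithm_run \<Theta> Z n A D
    using A trD(1) by unfold_locales (auto simp: tracer_def)
  obtain b B N proj where chain: "subgaussian_chain d (Theta_norm \<Theta>) b B \<Theta> N proj D \<phi>"
    using subgaussian_tracer_chain[OF \<Theta> tr] .
  have "\<P>((S, \<theta>) in run_law \<Theta> {0..n} n D A. T / 4 \<le> \<phi> \<theta> (S 0)) \<le> 2 * exp (- ((T / 4)\<^sup>2 / 9))"
    using subgaussian_chain.tail_bound[OF chain, of _ "T / 4"] T(1) by (intro soundness_le \<phi>) auto
  \<comment> \<open>144 = 4^2 * 9, from the threshold T / 4 and the scale 3. Half of the exponent is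
    spent on absorbing the factor 2, which works as T^2 / 288 is at least 1.\<close>
  also have "2 * exp (- ((T / 4)\<^sup>2 / 9)) \<le> exp (T\<^sup>2 / 288) * exp (- (T\<^sup>2 / 144))"
  proof (intro mult_mono)
    have "2 \<le> exp (1::real)" using exp_ge_add_one_self[of "1::real"] by simp
    also have "\<dots> \<le> exp (T\<^sup>2 / 288)" using T(2) by simp
    finally show "2 \<le> exp (T\<^sup>2 / 288)" .
  qed (auto simp: power_divide)
  also have "\<dots> = exp (- (T\<^sup>2 / 288))" by (simp flip: exp_add)
  finally have "\<P>((S, \<theta>) in run_law \<Theta> {0..n} n D A. T / 4 \<le> \<phi> \<theta> (S 0)) \<le> exp (- (T\<^sup>2 / 288))" .
  moreover have "(real n)\<^sup>2 * T\<^sup>2 / (9600 * (real n + real d))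
      \<le> (\<integral>(S, \<theta>). real (card {i \<in> {1..n}. T / 4 \<le> \<phi> \<theta> (S i)}) \<partial>run_law \<Theta> {0..n} n D A)"
    unfolding expected_card_eq[OF \<phi>] by (rule recall_ge[OF chain \<phi> trD(2) \<kappa> n T(1) mean])
  ultimately show ?thesis using trD(1) unfolding traceable_def by blast
qed

text \<open>
  For bounded \<open>T\<close> the tail bound \<open>2 exp(- T\<^sup>2 / 144)\<close> need not lie below \<open>exp(- c T\<^sup>2)\<close>; this replaces it.
\<close>

lemma traceable_half:
  assumes A: "algorithm \<Theta> Z n A" and "nontrivial_space Z"
  shows "traceable \<Theta> Z n A (1 / 2) (real n / 2)"
proof -
  obtain E x y where E: "E \<in> sets Z" "x \<in> E" "y \<in> space Z" "y \<notin> E"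
    using assms(2) sets.sets_into_space unfolding nontrivial_space_def by blast
  have x: "x \<in> space Z" using E sets.sets_into_space by blast
  \<comment> \<open>A fair coin decides between a point inside and a point outside E. The tracer is
    the indicator of E and ignores the parameter, so its scores are the same for every
    algorithm.\<close>
  define D where "D = distr (measure_pmf (bernoulli_pmf (1/2))) Z (\<lambda>b. if b then x else y)"
  have D: "D \<in> space (prob_algebra Z)"
    unfolding D_def space_prob_algebra using x E(3) by (auto intro!: measure_pmf.prob_space_distr)
  define \<phi> :: "(nat \<Rightarrow> real) \<Rightarrow> 'a \<Rightarrow> real" where "\<phi> \<theta> z = indicator E z" for \<theta> z
  have \<phi>: "(\<lambda>(\<theta>, z). \<phi> \<theta> z) \<in> borel_measurable (param_space \<Theta> \<Otimes>\<^sub>M Z)"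
    unfolding \<phi>_def case_prod_unfold using E(1) by (intro measurable_compose[OF measurable_snd]) simp
  interpret algorithm_run \<Theta> Z n A D using A D by unfold_locales
  have "emeasure D E = emeasure (measure_pmf (bernoulli_pmf (1/2))) {True}"
    unfolding D_def using E x by (subst emeasure_distr) (auto intro!: arg_cong2[where f = emeasure] split: if_splits)
  also have "\<dots> = ennreal (1 / 2)" by (simp add: emeasure_pmf_single)
  finally have DE: "(\<integral>\<^sup>+ z. indicator E z \<partial>D) = ennreal (1 / 2)"
    using E(1) by (subst nn_integral_indicator) (simp_all add: sets_D)
  have ind: "indicator {1..} (\<phi> \<theta> z) = (indicator E z :: 'b :: zero_neq_one)" for \<theta> z
    by (auto simp: \<phi>_def split: split_indicator)
  have "\<P>((S, \<theta>) in run_law \<Theta> {0..n} n D A. 1 \<le> \<phi> \<theta> (S 0)) \<le> 1 / 2"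
    by (rule soundness_le[OF \<phi>]) (simp_all add: ind DE)
  moreover have "real n / 2 \<le> (\<integral>(S, \<theta>). real (card {i \<in> {1..n}. 1 \<le> \<phi> \<theta> (S i)}) \<partial>run_law \<Theta> {0..n} n D A)"
  proof -
    let ?R = "run_law \<Theta> {1..n} n D A"
    have m: "(\<lambda>(S, \<theta>). indicator E (S i) :: ennreal) \<in> borel_measurable ?R" if "i \<in> {1..n}" for i
    proof -
      have "indicator E \<in> borel_measurable D" using E(1) by (simp add: sets_D)
      from measurable_compose[OF measurable_compose[OF measurable_fst measurable_component_singleton[OF that, of "\<lambda>_. D"]] this]
      show ?thesis by (simp add: measurable_run_law case_prod_unfold)
    qed
    have "(\<integral>\<^sup>+ w. ennreal (count_hits \<phi> 1 w) \<partial>?R) = (\<integral>\<^sup>+ w. (\<Sum>i=1..n. case w of (S, \<theta>) \<Rightarrow> indicator E (S i)) \<partial>?R)"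
      by (intro nn_integral_cong) (auto simp: count_hits_def ind ennreal_indicator sum_ennreal[symmetric] split: prod.split)
    also have "\<dots> = (\<Sum>i=1..n. \<integral>\<^sup>+ (S, \<theta>). indicator E (S i) \<partial>?R)"
      by (rule nn_integral_sum[OF m])
    also have "\<dots> = (\<Sum>i=1..n. ennreal (1 / 2))"
      using E(1) by (intro sum.cong refl) (subst nn_integral_sample_run, auto simp: DE sets_D)
    also have "\<dots> = ennreal (real n / 2)"
      by (subst sum_ennreal) auto
    finally have "(\<integral>\<^sup>+ w. ennreal (count_hits \<phi> 1 w) \<partial>?R) = ennreal (real n / 2)" .
    moreover have "integrable ?R (count_hits \<phi> 1)"
      using count_hits_measurable[OF \<phi>] count_hits_bounds
      by (intro integrable_run_law_bounded[where c = "real n"]) auto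
    ultimately have "(\<integral>w. count_hits \<phi> 1 w \<partial>?R) = real n / 2"
      using nn_integral_eq_integral[of ?R "count_hits \<phi> 1"] count_hits_bounds
      by (simp add: integral_nonneg_AE)
    then show ?thesis unfolding expected_card_eq[OF \<phi>] by simp
  qed
  moreover have "tracer \<Theta> Z \<phi> D" using \<phi> D by (simp add: tracer_def)
  ultimately show ?thesis unfolding traceable_def by blast
qed

lemma traceable_mono:
  "traceable \<Theta> Z n A \<xi> m \<Longrightarrow> \<xi> \<le> \<xi>' \<Longrightarrow> m' \<le> m \<Longrightarrow> traceable \<Theta> Z n A \<xi>' m'"
  unfolding traceable_def by (meson order_trans)

section \<open>From the trace value to a tracer\<close>

abbreviation payoff ::
  "(nat \<Rightarrow> real) set \<Rightarrow> nat \<Rightarrow> 'z alg \<Rightarrow> ((nat \<Rightarrow> real) \<Rightarrow> 'z \<Rightarrow> real) \<Rightarrow> 'z measure \<Rightarrow> real" where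
  "payoff \<Theta> n A \<phi> D \<equiv> \<integral>(S, \<theta>). 1 / real n * (\<Sum>i=1..n. \<phi> \<theta> (S i)) \<partial>run_law \<Theta> {1..n} n D A"

text \<open>A uniform bound on the payoffs is what makes the real-valued supremum in
  \<open>trace_value\<close> meaningful.\<close>

lemma abs_payoff_le:
  assumes "algorithm \<Theta> Z n A" "(\<phi>, D) \<in> subgaussian_tracers \<kappa> \<Theta> Z" "0 \<le> \<kappa>"
  shows "\<bar>payoff \<Theta> n A \<phi> D\<bar> \<le> \<kappa>"
proof -
  have trD: "tracer \<Theta> Z \<phi> D" "\<And>\<theta> z. \<theta> \<in> \<Theta> \<Longrightarrow> z \<in> space Z \<Longrightarrow> \<bar>\<phi> \<theta> z\<bar> \<le> \<kappa>"
    using assms(2) by (auto simp: subgaussian_tracers_def)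
  then have \<phi>: "(\<lambda>(\<theta>, z). \<phi> \<theta> z) \<in> borel_measurable (param_space \<Theta> \<Otimes>\<^sub>M Z)" by (simp add: tracer_def)
  interpret algorithm_run \<Theta> Z n A D
    using assms(1) trD(1) by unfold_locales (auto simp: tracer_def)
  interpret R: prob_space "run_law \<Theta> {1..n} n D A" by (rule prob_space_run_law) simp
  define f where "f = (\<lambda>(S, \<theta>). 1 / real n * (\<Sum>i=1..n. \<phi> \<theta> (S i)))"
  have f: "\<bar>f w\<bar> \<le> \<kappa>" if "w \<in> space (run_law \<Theta> {1..n} n D A)" for w
    using that mean_bound[OF trD(2) assms(3)] by (auto simp: f_def space_run_law)
  have int: "integrable (run_law \<Theta> {1..n} n D A) f"
    unfolding f_def by (rule integrable_run_law_bounded[OF sum_measurable[OF \<phi>]])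
      (unfold case_prod_conv, rule mean_bound[OF trD(2) assms(3)])
  have "(\<integral>w. f w \<partial>run_law \<Theta> {1..n} n D A) \<le> \<kappa>"
    using f by (intro R.integral_le_const[OF int] AE_I2) force
  moreover have "- \<kappa> \<le> (\<integral>w. f w \<partial>run_law \<Theta> {1..n} n D A)"
    using f by (intro R.integral_ge_const[OF int] AE_I2) force
  ultimately show ?thesis unfolding f_def by simp
qed

text \<open>It makes the set of tracers nonempty and, having payoff 0, every inner supremum in
  \<open>trace_value\<close> nonnegative.\<close>

lemma zero_tracer:
  assumes "convex_body d \<Theta>" "D \<in> space (prob_algebra Z)" "0 \<le> \<kappa>"
  shows "(\<lambda>_ _. 0, D) \<in> subgaussian_tracers \<kappa> \<Theta> Z"
proof -
  obtain b B where "equivalent_seminorm d (Theta_norm \<Theta>) b B"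
    using Theta_norm_equivalent_seminorm[OF assms(1)] .
  then interpret equivalent_seminorm d "Theta_norm \<Theta>" b B .
  have \<Theta>: "\<Theta> \<subseteq> Rspace d" using assms by (simp add: convex_body_def)
  have "prob_space D" using assms(2) by (simp add: space_prob_algebra)
  note zero_norm = psi2_norm_zero[OF this]
  have "0 \<le> Theta_norm \<Theta> (s - t)" if "s \<in> \<Theta>" "t \<in> \<Theta>" for s t
    using that \<Theta> by (intro nonneg Rspace_closed) auto
  then have "subgaussian_process 1 \<Theta> (Theta_norm \<Theta>) D (\<lambda>_ _. 0)"
    using zero_norm diam_wrt_bounds(2)[OF assms(1)]
    unfolding subgaussian_process_def by (auto intro: order_trans)
  moreover have "separable_process \<Theta> D (\<lambda>_ _. 0)"
  proof -
    \<comment> \<open>The paths are constant, so any countable dense subset of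
      \<open>\<Theta>\<close> witnesses separability.\<close>
    obtain \<Theta>\<^sub>0 where "countable \<Theta>\<^sub>0" "\<Theta>\<^sub>0 \<subseteq> \<Theta>" "\<Theta> \<subseteq> closure \<Theta>\<^sub>0" by (rule separable)
    then show ?thesis unfolding separable_process_def closure_sequential subset_iff
      by (intro exI[of _ \<Theta>\<^sub>0]) (simp add: closure_sequential)
  qed
  ultimately show ?thesis using assms by (simp add: subgaussian_tracers_def tracer_def)
qed

text \<open>T is an infimum over learners, hence a lower bound on the supremum for A itself. That
  supremum need not be attained, but for T > 0 some tracer exceeds T / 2.\<close>

lemma trace_value_attained_half:
  assumes \<Theta>: "convex_body d \<Theta>" and ne: "space Z \<noteq> {}" and \<kappa>: "0 \<le> \<kappa>" and A: "alpha_learner \<Theta> Z f n \<alpha> A"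
  defines "T \<equiv> trace_value \<kappa> \<Theta> Z f n \<alpha>"
  shows "0 \<le> T" "0 < T \<Longrightarrow> \<exists>(\<phi>, D)\<in>subgaussian_tracers \<kappa> \<Theta> Z. T / 2 \<le> payoff \<Theta> n A \<phi> D"
proof -
  define V where "V A = (SUP (\<phi>, D)\<in>subgaussian_tracers \<kappa> \<Theta> Z. payoff \<Theta> n A \<phi> D)" for A
  have T: "T = (INF A\<in>{A. alpha_learner \<Theta> Z f n \<alpha> A}. V A)"
    by (simp add: T_def trace_value_def V_def)
  obtain x where "x \<in> space Z" using ne by blast
  then have "return Z x \<in> space (prob_algebra Z)" by (simp add: space_prob_algebra prob_space_return)
  from zero_tracer[OF \<Theta> this \<kappa>] have zero: "(\<lambda>_ _. 0, return Z x) \<in> subgaussian_tracers \<kappa> \<Theta> Z" .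
  have V: "0 \<le> V A'" if "alpha_learner \<Theta> Z f n \<alpha> A'" for A'
  proof -
    have "payoff \<Theta> n A' (\<lambda>_ _. 0) (return Z x) \<le> V A'"
      unfolding V_def
    proof (rule cSUP_upper2[OF _ zero])
      have "algorithm \<Theta> Z n A'" using that by (simp add: alpha_learner_def)
      from abs_payoff_le[OF this _ \<kappa>]
      show "bdd_above ((\<lambda>(\<phi>, D). payoff \<Theta> n A' \<phi> D) ` subgaussian_tracers \<kappa> \<Theta> Z)"
        by (intro bdd_aboveI2[where M = \<kappa>]) (auto dest: abs_le_D1)
    qed simp
    moreover have "payoff \<Theta> n A' (\<lambda>_ _. 0) (return Z x) = 0" by (simp add: case_prod_unfold)
    ultimately show ?thesis by simp
  qed
  show "0 \<le> T" unfolding T using A V by (intro cINF_greatest) auto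
  assume "0 < T"
  have "T \<le> V A" unfolding T using A V by (intro cINF_lower) (auto intro!: bdd_belowI2[where m = 0])
  with \<open>0 < T\<close> have "T / 2 < V A" by simp
  then have "\<exists>t\<in>(\<lambda>(\<phi>, D). payoff \<Theta> n A \<phi> D) ` subgaussian_tracers \<kappa> \<Theta> Z. T / 2 < t"
    unfolding V_def by (rule less_cSupD[rotated]) (use zero in blast)
  then show "\<exists>(\<phi>, D)\<in>subgaussian_tracers \<kappa> \<Theta> Z. T / 2 \<le> payoff \<Theta> n A \<phi> D" by force
qed

lemma traceable_universal:
  assumes "0 < \<kappa>" "sco_problem d \<Theta> Z f" "nontrivial_space Z" and A: "alpha_learner \<Theta> Z f n \<alpha> A"
  defines "T \<equiv> trace_value \<kappa> \<Theta> Z f n \<alpha>"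
  shows "traceable \<Theta> Z n A (exp (- (1 / 10000) * T\<^sup>2))
    (1 / 10000 * ((real n)\<^sup>2 * T\<^sup>2 / (real n + real d) - 16 * \<kappa>\<^sup>2 * real n / exp (real n + real d)))"
proof -
  have \<Theta>: "convex_body d \<Theta>" using assms(2) by (simp add: sco_problem_def)
  have alg: "algorithm \<Theta> Z n A" using A by (simp add: alpha_learner_def)
  have ne: "space Z \<noteq> {}" using assms(3) sets.sets_into_space by (fastforce simp: nontrivial_space_def)
  define m where "m = (real n)\<^sup>2 * T\<^sup>2 / (real n + real d)"
  have m: "0 \<le> m" by (simp add: m_def)
  \<comment> \<open>The subtracted term is nonnegative, so it suffices to reach m / 10000.\<close>
  have m_le: "1 / 10000 * (m - 16 * \<kappa>\<^sup>2 * real n / exp (real n + real d)) \<le> m / 10000" by simp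
  show ?thesis
  proof (cases "T\<^sup>2 \<le> 288")
    case True
    \<comment> \<open>With T^2 <= 288 the guarantees of \<open>traceable_half\<close> suffice: 1 -
      288 / 10000 >= 1 / 2 for soundness and 288 / 10000 <= 1 / 2 for recall.\<close>
    have "1 / 2 \<le> 1 + (- (1 / 10000) * T\<^sup>2)" using True by simp
    also have "\<dots> \<le> exp (- (1 / 10000) * T\<^sup>2)" by (rule exp_ge_add_one_self)
    finally have \<xi>: "1 / 2 \<le> exp (- (1 / 10000) * T\<^sup>2)" .
    have "m \<le> real n * 288"
    \<comment> \<open>For n = 0 the denominator n + d may vanish.\<close>
    proof (cases "n = 0")
      case False
      have "(real n)\<^sup>2 * T\<^sup>2 \<le> (real n)\<^sup>2 * 288" using True by (intro mult_left_mono) auto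
      also have "\<dots> \<le> real n * 288 * (real n + real d)" by (simp add: power2_eq_square algebra_simps)
      finally show ?thesis using False by (simp add: m_def divide_le_eq)
    qed (simp add: m_def)
    then have "m / 10000 \<le> real n / 2" by simp
    then have "1 / 10000 * (m - 16 * \<kappa>\<^sup>2 * real n / exp (real n + real d)) \<le> real n / 2"
      using m_le by linarith
    then show ?thesis
      unfolding m_def by (rule traceable_mono[OF traceable_half[OF alg assms(3)] \<xi>])
  next
    case False
    have "0 \<le> T" unfolding T_def by (rule trace_value_attained_half(1)[OF \<Theta> ne _ A]) (use assms(1) in simp)
    moreover have "T \<noteq> 0" using False by auto
    ultimately have T: "0 < T" by simp
    then obtain \<phi> D where tr: "(\<phi>, D) \<in> subgaussian_tracers \<kappa> \<Theta> Z" "T / 2 \<le> payoff \<Theta> n A \<phi> D"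
      using trace_value_attained_half(2)[OF \<Theta> ne _ A, of \<kappa>] assms(1) unfolding T_def by fastforce
    \<comment> \<open>A mean over no samples is 0 and cannot reach T / 2.\<close>
    have "n \<noteq> 0"
    proof
      assume "n = 0"
      then have "payoff \<Theta> n A \<phi> D = 0" by (simp add: case_prod_unfold)
      then show False using tr(2) T by simp
    qed
    then have "traceable \<Theta> Z n A (exp (- (T\<^sup>2 / 288))) ((real n)\<^sup>2 * T\<^sup>2 / (9600 * (real n + real d)))"
      using traceable_large[OF \<Theta> alg tr(1) _ _ T _ tr(2)] False assms(1) by simp
    \<comment> \<open>1 / 10000 is below both 1 / 288 and 1 / 9600, so it covers soundness and
      recall.\<close>
    moreover have "exp (- (T\<^sup>2 / 288)) \<le> exp (- (1 / 10000) * T\<^sup>2)" by simp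
    moreover have "(real n)\<^sup>2 * T\<^sup>2 / (9600 * (real n + real d)) = m / 9600" by (simp add: m_def)
    then have "1 / 10000 * (m - 16 * \<kappa>\<^sup>2 * real n / exp (real n + real d)) \<le> (real n)\<^sup>2 * T\<^sup>2 / (9600 * (real n + real d))"
      using m_le m by linarith
    ultimately show ?thesis unfolding m_def[symmetric] by (rule traceable_mono)
  qed
qed

theorem theorem3p5:
  shows "\<exists>c>0. \<forall>(n::nat) (d::nat) (\<kappa>::real) (\<alpha>::real) \<Theta> (Z::'z measure) f.
    0 < \<kappa> \<longrightarrow> \<alpha> \<in> {0..1} \<longrightarrow> sco_problem d \<Theta> Z f \<longrightarrow> nontrivial_space Z \<longrightarrow>
    (let T = trace_value \<kappa> \<Theta> Z f n \<alpha> in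
      \<forall>A. alpha_learner \<Theta> Z f n \<alpha> A \<longrightarrow>
        traceable \<Theta> Z n A (exp (- c * T\<^sup>2))
          (c * ((real n)\<^sup>2 * T\<^sup>2 / (real n + real d) - 16 * \<kappa>\<^sup>2 * real n / exp (real n + real d))))"
  unfolding Let_def
  by (intro exI[of _ "1 / 10000 :: real"] conjI allI impI traceable_universal) auto

end
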